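(* Let $G$ be a simple graph on vertex set $[n]$ that is semi-symmetrized $e$-positive, and let $m\ge1$. Then the concatenation $G\cdot TL_m$ is semi-symmetrized $e$-positive.
   Context: $TL_m$ is the graph on $[m]$ with an edge between $i,j$ exactly when $1\le|i-j|\le2$. For graphs $G$ on $[n]$ and $H$ on $[m]$, the concatenation $G\cdot H$ is the graph on $[n+m-1]$ whose edges are the edges of $G$ together with the edges of $H$ with both endpoints shifted by $n-1$ (so vertex $n$ of $G$ is identified with vertex $1$ of $H$). For a simple graph $G$ on $[n]$, $Y_G=\sum_\kappa x_{\kappa(1)}\cdots x_{\kappa(n)}$ in non-commuting variables $x_1,x_2,\dots$, summed over proper colorings $\kappa:[n]\to\{1,2,\dots\}$. For $\pi\vdash[n]$, $e_\pi=\sum x_{i_1}\cdots x_{i_n}$ over tuples with $i_j\ne i_k$ whenever $j\ne k$ are in a common block. For $\pi,\sigma\vdash[n]$, $\pi\sim\sigma$ if they have the same multiset of block sizes and the blocks containing $n$ have equal size; $f\equiv_n g$ means that for each $\sim$-class the sums of $e$-coefficients of $f$ and $g$ over the class agree. A graph $G$ on $[n]$ is semi-symmetrized $e$-positive if $Y_G\equiv_n g$ for some nonnegative linear combination $g$ of the $e_\pi$, $\pi\vdash[n]$. *)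

theory Defs
  imports Complex_Main "HOL-Library.FuncSet" "HOL-Library.Disjoint_Sets" "HOL-Library.Multiset"
begin

definition simple_graph :: "nat \<Rightarrow> nat set set \<Rightarrow> bool" where
  "simple_graph n E \<longleftrightarrow> (\<forall>e\<in>E. \<exists>i j. e = {i, j} \<and> i \<noteq> j \<and> i \<in> {1..n} \<and> j \<in> {1..n})"

definition TL :: "nat \<Rightarrow> nat set set" where
  "TL m = {{i, j} | i j. i \<in> {1..m} \<and> j \<in> {1..m} \<and> i < j \<and> j \<le> i + 2}"

definition graph_concat :: "nat \<Rightarrow> nat set set \<Rightarrow> nat set set \<Rightarrow> nat set set" where
  "graph_concat n E H = E \<union> (\<lambda>e. (\<lambda>i. i + n - 1) ` e) ` H"

text \<open>Noncommutative series in x_1, x_2, ... restricted to degree-n words are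
  coefficient functions on words \<kappa> : [n] \<rightarrow> {1,2,...}; the word
  x_{\<kappa>(1)} ... x_{\<kappa>(n)}.\<close>
definition words :: "nat \<Rightarrow> (nat \<Rightarrow> nat) set" where
  "words n = {1..n} \<rightarrow>\<^sub>E {1..}"

definition proper_coloring :: "nat set set \<Rightarrow> (nat \<Rightarrow> nat) \<Rightarrow> bool" where
  "proper_coloring E \<kappa> \<longleftrightarrow> (\<forall>i j. {i, j} \<in> E \<and> i \<noteq> j \<longrightarrow> \<kappa> i \<noteq> \<kappa> j)"

definition YG :: "nat set set \<Rightarrow> (nat \<Rightarrow> nat) \<Rightarrow> real" where
  "YG E \<kappa> = (if proper_coloring E \<kappa> then 1 else 0)"

definition e_basis :: "nat set set \<Rightarrow> (nat \<Rightarrow> nat) \<Rightarrow> real" where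
  "e_basis \<pi> \<kappa> = (if \<forall>B\<in>\<pi>. inj_on \<kappa> B then 1 else 0)"

definition set_partitions :: "nat \<Rightarrow> nat set set set" where
  "set_partitions n = {\<pi>. partition_on {1..n} \<pi>}"

definition block_of :: "nat set set \<Rightarrow> nat \<Rightarrow> nat set" where
  "block_of \<pi> x = (THE B. B \<in> \<pi> \<and> x \<in> B)"

definition part_sim :: "nat \<Rightarrow> nat set set \<Rightarrow> nat set set \<Rightarrow> bool" where
  "part_sim n \<pi> \<sigma> \<longleftrightarrow> image_mset card (mset_set \<pi>) = image_mset card (mset_set \<sigma>)
     \<and> card (block_of \<pi> n) = card (block_of \<sigma> n)"

definition e_expansion :: "nat \<Rightarrow> ((nat \<Rightarrow> nat) \<Rightarrow> real) \<Rightarrow> (nat set set \<Rightarrow> real) \<Rightarrow> bool" where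
  "e_expansion n f c \<longleftrightarrow>
     (\<forall>\<kappa>\<in>words n. f \<kappa> = (\<Sum>\<pi>\<in>set_partitions n. c \<pi> * e_basis \<pi> \<kappa>))"

definition sym_equiv :: "nat \<Rightarrow> ((nat \<Rightarrow> nat) \<Rightarrow> real) \<Rightarrow> ((nat \<Rightarrow> nat) \<Rightarrow> real) \<Rightarrow> bool" where
  "sym_equiv n f g \<longleftrightarrow> (\<exists>cf cg. e_expansion n f cf \<and> e_expansion n g cg \<and>
     (\<forall>\<pi>\<in>set_partitions n.
        (\<Sum>\<sigma>\<in>{\<sigma>\<in>set_partitions n. part_sim n \<pi> \<sigma>}. cf \<sigma>)
      = (\<Sum>\<sigma>\<in>{\<sigma>\<in>set_partitions n. part_sim n \<pi> \<sigma>}. cg \<sigma>)))"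

definition semi_sym_e_positive :: "nat \<Rightarrow> nat set set \<Rightarrow> bool" where
  "semi_sym_e_positive n E \<longleftrightarrow> (\<exists>d. (\<forall>\<pi>\<in>set_partitions n. d \<pi> \<ge> 0) \<and>
     sym_equiv n (YG E) (\<lambda>\<kappa>. \<Sum>\<pi>\<in>set_partitions n. d \<pi> * e_basis \<pi> \<kappa>))"

end

(*
Keep track of the colour of the last vertex only: in the ring of polynomials in commuting colour
variables, a word k contributes the product of x_k(i), i < n, to the component of the colour k(n).
Then e_pi turns into the product of the |B|! e_|B| over the blocks B not containing n, times
(k-1)! E_k(x_a), where k is the size of the block of n, a is the last colour, and
E_k(z) = e_(k-1) - z E_(k-1)(z) is the elementary symmetric polynomial of degree k-1 in the
variables other than z. Since the e_pi are linearly independent, averaging over the permutations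
fixing n shows that no information modulo the relation on partitions is lost. So it suffices that
attaching a triangular ladder preserves the cone generated by the products of the e_j with an E_k.

Attaching a vertex to the last two vertices acts on functions f(y,z) of their colours by
f |-> F(z) - w f(w,z), F(z) = (sum over all variables y of y f(y,z)) - z f(z,z).
Starting from E_k(y), this creates products E_i E_j of polynomials in the same variable, whose
expansion has negative terms; these are absorbed by bundling the products with suitable weights.
*)
theory Submission
  imports Defs "HOL-Library.Poly_Mapping" "HOL-Combinatorics.Permutations"
begin

section \<open>Polynomials recording the colours of the last vertices\<close>

text \<open>Products in one variable are straightened by \<open>E_mult_exchange\<close>: moving one
  unit of index between the factors costs \<open>e d * E m z - e m * E d z\<close>, whose second
  term is negative. In the collapse of \<open>Phi b t\<close>, with n = b + t + 1, the two weights
  at each c add up to \<open>pw (t + 2 - 2c) - pw (t - 2c)\<close>, so most of these costs telescope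
  away. What stays negative is \<open>pw (t + 1 - 2c)\<close> copies of
  \<open>e (n - c) * E c z\<close>. Against them stand \<open>dpw (t + 2 - 2c)\<close> times n - c -
  1 copies of the same term, and \<open>extend\<close> takes one more copy per unit of weight.
  Powers of two fit because \<open>dpw (j + 1) = pw j\<close> for j at least 0: a common factor can
  be pulled out, and the remaining integer is nonnegative once b is at least 2. For b = 1 the
  coefficient is -1 at t = c = 1. A last block of size 1 therefore follows a second family:
  \<open>E 1 z = 1 = D 2 y z\<close>, and the \<open>D j\<close> extend with no negative term at
  all. This is why the cone for two colours has two kinds of generators.\<close>

definition esym :: "('i \<Rightarrow> 'r::comm_ring_1) \<Rightarrow> 'i set \<Rightarrow> nat \<Rightarrow> 'r" where
  "esym x C k = (\<Sum>S | S \<subseteq> C \<and> card S = k. \<Prod>i\<in>S. x i)"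

lemma esym_0: "finite C \<Longrightarrow> esym x C 0 = 1"
proof -
  assume "finite C"
  then have "{S. S \<subseteq> C \<and> card S = 0} = {{}}"
    by (auto simp: finite_subset)
  then show ?thesis by (simp add: esym_def)
qed

lemma esym_Suc_split:
  assumes "finite C" "a \<in> C"
  shows "esym x C (Suc k) = esym x (C - {a}) (Suc k) + x a * esym x (C - {a}) k"
proof -
  let ?P = "\<lambda>S. \<Prod>i\<in>S. x i"
  let ?A = "{S. S \<subseteq> C - {a} \<and> card S = Suc k}"
  let ?B = "{S. S \<subseteq> C - {a} \<and> card S = k}"
  have eq: "{S. S \<subseteq> C \<and> card S = Suc k} = ?A \<union> insert a ` ?B" (is "?L = ?R")
  proof
    show "?L \<subseteq> ?R"
    proof
      fix S assume S: "S \<in> ?L"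
      show "S \<in> ?R"
      proof (cases "a \<in> S")
        case True
        then have "S = insert a (S - {a})" by auto
        moreover have "S - {a} \<in> ?B" using S True by (auto simp: card_Diff_singleton)
        ultimately show ?thesis by blast
      qed (use S in auto)
    qed
    show "?R \<subseteq> ?L"
      using assms by (auto simp: card_insert_if finite_subset[of _ "C - {a}"])
  qed
  have inj: "inj_on (insert a) ?B"
    by (auto simp: inj_on_def)
  have "esym x C (Suc k) = sum ?P ?A + sum ?P (insert a ` ?B)"
    unfolding esym_def eq by (rule sum.union_disjoint) (use assms in auto)
  also have "sum ?P (insert a ` ?B) = (\<Sum>S\<in>?B. x a * ?P S)"
    unfolding sum.reindex[OF inj] o_def
  proof (rule sum.cong)
    fix S assume "S \<in> ?B"
    then have "a \<notin> S" "finite S" using assms by (auto intro: finite_subset)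
    then show "?P (insert a S) = x a * ?P S" by simp
  qed simp
  finally show ?thesis by (simp add: esym_def sum_distrib_left)
qed

text \<open>Double counting of subsets with a marked element: a set of size k + 1 arises once from
  each of its elements.\<close>

lemma sum_esym_remove:
  assumes "finite C"
  shows "(\<Sum>a\<in>C. x a * esym x (C - {a}) k) = of_nat (Suc k) * esym x C (Suc k)"
proof -
  let ?P = "\<lambda>S. \<Prod>i\<in>S. x i"
  let ?L = "SIGMA a:C. {S. S \<subseteq> C - {a} \<and> card S = k}"
  let ?R = "SIGMA S:{S. S \<subseteq> C \<and> card S = Suc k}. S"
  have "(\<Sum>a\<in>C. x a * esym x (C - {a}) k) = (\<Sum>(a, S)\<in>?L. x a * ?P S)"
    unfolding esym_def sum_distrib_left using assms
    by (subst sum.Sigma) auto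
  also have "\<dots> = (\<Sum>(S, a)\<in>?R. ?P S)"
  proof (rule sum.reindex_bij_witness[where i = "\<lambda>(S, a). (a, S - {a})" and j = "\<lambda>(a, S). (insert a S, a)"])
    fix p assume "p \<in> ?L"
    then obtain a S where p: "p = (a, S)" "a \<in> C" "S \<subseteq> C - {a}" "card S = k" by auto
    then have f: "finite S" "a \<notin> S" using assms by (auto intro: finite_subset)
    then show "(case case p of (a, S) \<Rightarrow> (insert a S, a) of (S, a) \<Rightarrow> (a, S - {a})) = p"
      "(case p of (a, S) \<Rightarrow> (insert a S, a)) \<in> ?R"
      "(case case p of (a, S) \<Rightarrow> (insert a S, a) of (S, a) \<Rightarrow> ?P S) = (case p of (a, S) \<Rightarrow> x a * ?P S)"
      using p by auto
  next
    fix p assume "p \<in> ?R"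
    then obtain a S where p: "p = (S, a)" "a \<in> S" "S \<subseteq> C" "card S = Suc k" by auto
    then show "(case case p of (S, a) \<Rightarrow> (a, S - {a}) of (a, S) \<Rightarrow> (insert a S, a)) = p"
      "(case p of (S, a) \<Rightarrow> (a, S - {a})) \<in> ?L"
      by (auto simp: card_Diff_singleton)
  qed
  also have "\<dots> = (\<Sum>S | S \<subseteq> C \<and> card S = Suc k. \<Sum>a\<in>S. ?P S)"
    using assms by (subst sum.Sigma) (auto intro: finite_subset)
  also have "\<dots> = (\<Sum>S | S \<subseteq> C \<and> card S = Suc k. of_nat (Suc k) * ?P S)"
    by (intro sum.cong) auto
  finally show ?thesis by (simp only: esym_def sum_distrib_left)
qed

definition pw :: "int \<Rightarrow> int" where
  "pw j = (if j < 0 then 0 else 2 ^ nat j)"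

definition dpw :: "int \<Rightarrow> int" where
  "dpw j = pw j - pw (j - 1)"

lemma pw_neg: "j < 0 \<Longrightarrow> pw j = 0"
  by (simp add: pw_def)

lemma pw_0: "pw 0 = 1"
  by (simp add: pw_def)

lemma pw_nonneg: "0 \<le> pw j"
  by (simp add: pw_def)

lemma dpw_neg: "j < 0 \<Longrightarrow> dpw j = 0"
  by (simp add: dpw_def pw_neg)

lemma pw_pos_step: "0 < j \<Longrightarrow> pw j = 2 * pw (j - 1)"
proof -
  assume "0 < j"
  then have "nat j = Suc (nat (j - 1))" by simp
  then show ?thesis using \<open>0 < j\<close> by (simp add: pw_def)
qed

lemma dpw_pos: "0 < j \<Longrightarrow> dpw j = pw (j - 1)"
  by (simp add: dpw_def pw_pos_step)

lemma dpw_0: "dpw 0 = 1"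
  by (simp add: dpw_def pw_def)

lemma dpw_nonneg: "0 \<le> dpw j"
  by (cases "j < 0"; cases "j = 0") (auto simp: dpw_neg dpw_0 dpw_pos pw_nonneg)

text \<open>The ring stays abstract, and functions of a colour take arbitrary ring elements instead
  of letters: \<open>collapse\<close> evaluates \<open>f\<close> at equal arguments, where no word
  with adjacent last vertices exists. \<open>cst\<close> embeds the real coefficients.\<close>

locale alphabet =
  fixes C :: "'i set" and x :: "'i \<Rightarrow> 'r::{comm_ring_1,ring_char_0}" and cst :: "real \<Rightarrow> 'r"
  assumes fin: "finite C"
    and cst_0: "cst 0 = 0" and cst_1: "cst 1 = 1"
    and cst_add: "cst (a + b) = cst a + cst b"
    and cst_mult: "cst (a * b) = cst a * cst b"
begin

section \<open>Elementary symmetric polynomials with one or two letters removed\<close>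

lemma cst_of_nat: "cst (of_nat k) = of_nat k"
  by (induction k) (auto simp: cst_0 cst_1 cst_add)

definition e :: "nat \<Rightarrow> 'r" where
  "e k = esym x C k"

lemma e_0: "e 0 = 1"
  using fin by (simp add: e_def esym_0)

text \<open>The index is the size of the block of the last vertex, one more than the degree, since
  the last letter is not recorded. The value 0 at index 0 gives \<open>E 1 z = 1\<close>.\<close>

primrec E :: "nat \<Rightarrow> 'r \<Rightarrow> 'r" where
  "E 0 z = 0"
| "E (Suc k) z = e k - z * E k z"

lemma E_eq_esym: "a \<in> C \<Longrightarrow> E (Suc k) (x a) = esym x (C - {a}) k"
proof (induction k)
  case 0
  then show ?case using fin by (simp add: esym_0 e_0)
next
  case (Suc k)
  have "E (Suc (Suc k)) (x a) = esym x C (Suc k) - x a * E (Suc k) (x a)"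
    by (simp add: e_def)
  then show ?case
    using Suc esym_Suc_split[OF fin, of a x k] by simp
qed

text \<open>The factor \<open>x a\<close> records the letter of a vertex that is not the last
  one.\<close>

definition tr :: "('r \<Rightarrow> 'r) \<Rightarrow> 'r" where
  "tr f = (\<Sum>a\<in>C. x a * f (x a))"

lemma tr_add: "tr (\<lambda>y. f y + g y) = tr f + tr g"
  by (simp add: tr_def sum.distrib algebra_simps)

lemma tr_cmult: "tr (\<lambda>y. r * f y) = r * tr f"
  by (simp add: tr_def sum_distrib_left algebra_simps)

lemma tr_0: "tr (\<lambda>y. 0) = 0"
  by (simp add: tr_def)

lemma tr_E: "tr (E k) = of_nat k * e k"
proof (cases k)
  case 0
  then show ?thesis by (simp add: tr_def)
next
  case (Suc j)
  have "tr (E k) = (\<Sum>a\<in>C. x a * esym x (C - {a}) j)"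
    unfolding tr_def Suc by (intro sum.cong) (simp_all only: E_eq_esym)
  then show ?thesis using sum_esym_remove[OF fin, of x j] Suc by (simp add: e_def)
qed

text \<open>For \<open>f y z\<close> recording the colours of the last two vertices, \<open>collapse f\<close> forgets the
  last but one colour, and \<open>extend f\<close> attaches a new vertex to both of them.\<close>

definition collapse :: "('r \<Rightarrow> 'r \<Rightarrow> 'r) \<Rightarrow> 'r \<Rightarrow> 'r" where
  "collapse f z = tr (\<lambda>y. f y z) - z * f z z"

definition extend :: "('r \<Rightarrow> 'r \<Rightarrow> 'r) \<Rightarrow> 'r \<Rightarrow> 'r \<Rightarrow> 'r" where
  "extend f z w = collapse f z - w * f w z"

lemma collapse_add: "collapse (\<lambda>y z. f y z + g y z) = (\<lambda>z. collapse f z + collapse g z)"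
  by (simp add: collapse_def tr_add algebra_simps fun_eq_iff)

lemma collapse_cmult: "collapse (\<lambda>y z. r * f y z) = (\<lambda>z. r * collapse f z)"
  by (simp add: collapse_def tr_cmult algebra_simps fun_eq_iff)

lemma collapse_0: "collapse (\<lambda>y z. 0) = (\<lambda>z. 0)"
  by (simp add: collapse_def tr_0 fun_eq_iff)

lemma extend_add: "extend (\<lambda>y z. f y z + g y z) = (\<lambda>z w. extend f z w + extend g z w)"
  by (simp add: extend_def collapse_add algebra_simps fun_eq_iff)

lemma extend_cmult: "extend (\<lambda>y z. r * f y z) = (\<lambda>z w. r * extend f z w)"
  by (simp add: extend_def collapse_cmult algebra_simps fun_eq_iff)

lemma extend_0: "extend (\<lambda>y z. 0) = (\<lambda>z w. 0)"
  by (simp add: extend_def collapse_0 fun_eq_iff)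

text \<open>\<open>D k\<close> is the elementary symmetric polynomial of degree \<open>k - 2\<close> in the alphabet without
  the two distinct letters \<open>z\<close>, \<open>w\<close>.\<close>

primrec D :: "nat \<Rightarrow> 'r \<Rightarrow> 'r \<Rightarrow> 'r" where
  "D 0 z w = 0"
| "D (Suc k) z w = E k z - w * D k z w"

text \<open>Up to sign, \<open>D k\<close> is the divided difference of \<open>E k\<close>; its
  symmetry is derived from this.\<close>

lemma E_diff: "E k w - E k z = (z - w) * D k z w"
proof (induction k)
  case (Suc k)
  have "E (Suc k) w - E (Suc k) z = z * E k z - w * E k w" by simp
  also have "\<dots> = (z - w) * E k z - w * (E k w - E k z)" by (simp add: algebra_simps)
  finally show ?case by (simp add: Suc algebra_simps)
qed simp

text \<open>Used because \<open>extend\<close> evaluates its argument at \<open>w z\<close>, while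
  the recurrence of \<open>D\<close> multiplies \<open>D k z w\<close> by \<open>w\<close>.\<close>

lemma D_commute: "D k z w = D k w z"
proof (induction k)
  case (Suc k)
  have "D (Suc k) z w - D (Suc k) w z = (z - w) * D k z w - (E k w - E k z)"
    by (simp add: algebra_simps Suc)
  then show ?case by (simp add: E_diff)
qed simp

lemma D_2: "D 2 z w = 1"
  by (simp add: numeral_2_eq_2 e_0)

lemma collapse_D: "collapse (D (Suc k)) z = of_nat k * E (Suc k) z"
proof (induction k)
  case 0
  then show ?case by (simp add: collapse_def tr_0)
next
  case (Suc k)
  have eq: "D (Suc (Suc k)) = (\<lambda>y z. E (Suc k) y + (- z) * D (Suc k) y z)"
    by (simp add: fun_eq_iff)
  have "collapse (D (Suc (Suc k))) z = tr (E (Suc k)) - z * E (Suc k) z - z * collapse (D (Suc k)) z"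
    unfolding eq collapse_def tr_add tr_cmult by (simp add: algebra_simps del: E.simps)
  also have "\<dots> = of_nat (Suc k) * E (Suc (Suc k)) z"
    unfolding tr_E Suc by (simp add: algebra_simps)
  finally show ?case .
qed

text \<open>Collapsing yields k + 1 copies of \<open>E (k + 2) z\<close>; one of them and the
  subtracted term make up the next \<open>D\<close> by its recurrence.\<close>

lemma extend_D: "extend (D (Suc (Suc k))) z w = of_nat k * E (Suc (Suc k)) z + D (Suc (Suc (Suc k))) z w"
  by (simp only: extend_def collapse_D D_commute[of _ w z] D.simps(2)[of "Suc (Suc k)"])
     (simp add: algebra_simps del: D.simps E.simps)

text \<open>After one step of the recurrence in each product the terms
  \<open>z * E d z * E m z\<close> cancel. This is the straightening rule for products in one
  variable.\<close>

lemma E_mult_exchange: "E (Suc d) z * E m z - E d z * E (Suc m) z = e d * E m z - e m * E d z"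
  by (simp add: algebra_simps)

text \<open>Extending \<open>E i y * E j z\<close> produces the product \<open>E (i + 1) z * E j z\<close>, whose expansion in the
  \<open>E k z\<close> has the leading term \<open>E (i + j) z\<close> and negative terms. \<open>Phi b t\<close> bundles all products
  that descend in \<open>t\<close> extensions from \<open>E b y\<close> through leading terms: within this bundle the
  negative terms are outweighed. The weights \<open>dpw 0, dpw 1, \<dots> = 1, 1, 2, 4, \<dots>\<close> count the descents; each
  is the sum of all earlier ones.\<close>

definition Phi :: "nat \<Rightarrow> nat \<Rightarrow> 'r \<Rightarrow> 'r \<Rightarrow> 'r" where
  "Phi b t y z = (\<Sum>c=1..Suc t.
      of_int (dpw (int t + 2 - 2 * int c)) * (E (b + t + 1 - c) y * E c z)
    + of_int (dpw (int t + 1 - 2 * int c)) * (E c y * E (b + t + 1 - c) z))"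

lemma Phi_0: "Phi b 0 y z = E b y"
  by (simp add: Phi_def dpw_0 dpw_neg e_0)

text \<open>Abel summation in \<open>c\<close>: consecutive products differ by the exchange rule,
  and the chain starts at \<open>E 1 z * E n z = E n z\<close>.\<close>

lemma abel_sum_E:
  assumes "M \<le> n"
  shows "(\<Sum>c=1..M. of_int (A c - A (Suc c)) * (E c z * E (Suc n - c) z))
    = of_int (A 1) * E n z
      + (\<Sum>c=1..M. of_int (A (Suc c)) * (e c * E (n - c) z - e (n - c) * E c z))
      - of_int (A (Suc M)) * (E (Suc M) z * E (n - M) z)"
  using assms
proof (induction M)
  case 0
  then show ?case by (simp add: e_0)
next
  case (Suc M)
  have s: "E (Suc (Suc M)) z * E (n - Suc M) z - E (Suc M) z * E (n - M) z
      = e (Suc M) * E (n - Suc M) z - e (n - Suc M) * E (Suc M) z"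
    using E_mult_exchange[of "Suc M" z "n - Suc M"] Suc.prems by (simp add: Suc_diff_Suc del: E.simps)
  show ?case
    unfolding sum.cl_ivl_Suc s[symmetric] using Suc
    by (simp add: sum_subtractf sum.distrib algebra_simps del: E.simps)
qed

text \<open>The factor is n - c - 2 for n = b + t + 1: of the n - c copies of
  \<open>e (n - c)\<close> given by \<open>tr_E\<close>, one raises the index of a product in
  \<open>collapse\<close> and one is consumed by the term that \<open>extend\<close> subtracts. The
  subtracted \<open>pw\<close> comes from straightening.\<close>

definition Phi_coeff1 :: "nat \<Rightarrow> nat \<Rightarrow> nat \<Rightarrow> int" where
  "Phi_coeff1 b t c = dpw (int t + 2 - 2 * int c) * (int b + int t - int c - 1) - pw (int t + 1 - 2 * int c)"

definition Phi_coeff2 :: "nat \<Rightarrow> nat \<Rightarrow> int" where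
  "Phi_coeff2 t c = dpw (int t + 1 - 2 * int c) * (int c - 2) + pw (int t + 1 - 2 * int c)"

text \<open>Where the weight has positive index, \<open>dpw j = pw (j - 1)\<close> makes both
  summands multiples of the same power. There t is at least 2c - 1, so the cofactor is at least b +
  c - 3, which is where \<open>2 \<le> b\<close> enters.\<close>

lemma Phi_coeff1_nonneg:
  assumes "2 \<le> b" "1 \<le> c"
  shows "0 \<le> Phi_coeff1 b t c"
proof -
  consider "int t + 2 - 2 * int c < 0" | "int t + 2 - 2 * int c = 0" | "int t + 2 - 2 * int c > 0" by linarith
  then show ?thesis
  proof cases
    case 3
    then have "Phi_coeff1 b t c = pw (int t + 1 - 2 * int c) * (int b + int t - int c - 2)"
      by (simp add: Phi_coeff1_def dpw_pos algebra_simps)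
    moreover have "int b + int t - int c - 2 \<ge> 0" using 3 assms by linarith
    ultimately show ?thesis by (simp add: pw_nonneg)
  qed (use assms in \<open>auto simp: Phi_coeff1_def dpw_neg pw_neg dpw_0\<close>)
qed

text \<open>The first summand can be negative only for c = 1; the doubling
  \<open>pw j = 2 * pw (j - 1)\<close> pays for it.\<close>

lemma Phi_coeff2_nonneg:
  assumes "1 \<le> c"
  shows "0 \<le> Phi_coeff2 t c"
proof -
  consider "int t + 1 - 2 * int c < 0" | "int t + 1 - 2 * int c = 0" | "int t + 1 - 2 * int c > 0" by linarith
  then show ?thesis
  proof cases
    case 3
    then have "Phi_coeff2 t c = pw (int t - 2 * int c) * int c"
      by (simp add: Phi_coeff2_def dpw_pos pw_pos_step algebra_simps)
    then show ?thesis by (simp add: pw_nonneg)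
  qed (use assms in \<open>auto simp: Phi_coeff2_def dpw_neg pw_neg dpw_0 pw_0\<close>)
qed

lemma collapse_sum: "collapse (\<lambda>y z. \<Sum>c\<in>A. f c y z) z = (\<Sum>c\<in>A. collapse (f c) z)"
proof (cases "finite A")
  case True
  then show ?thesis
    by (induction A) (simp_all add: collapse_0 collapse_add)
qed (simp add: collapse_0)

lemma collapse_E_E: "collapse (\<lambda>y z. r * (E i y * E j z)) z = r * ((of_nat i * e i - z * E i z) * E j z)"
proof -
  have "tr (\<lambda>y. r * (E i y * E j z)) = r * E j z * tr (E i)"
    by (subst tr_cmult[symmetric]) (simp add: algebra_simps)
  then show ?thesis
    by (simp add: collapse_def tr_E algebra_simps)
qed

text \<open>Since \<open>e i - z * E i z\<close> is \<open>E (i + 1) z\<close>, collapsing raises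
  one index and leaves products whose indices sum to n + 1. Their weights are differences of
  \<open>pw\<close>, so \<open>abel_sum_E\<close> reduces them to the one leading term
  \<open>E n z\<close>.\<close>

lemma collapse_Phi:
  assumes n: "n = b + t + 1" and b: "1 \<le> b"
  shows "collapse (Phi b t) z = of_int (pw (int t)) * E n z
    + (\<Sum>c=1..Suc t. of_int (Phi_coeff1 b t c + dpw (int t + 2 - 2 * int c)) * (e (n - c) * E c z)
        + of_int (Phi_coeff2 t c + dpw (int t + 1 - 2 * int c)) * (e c * E (n - c) z))"
proof -
  let ?u = "\<lambda>c. dpw (int t + 2 - 2 * int c)" and ?v = "\<lambda>c. dpw (int t + 1 - 2 * int c)"
  let ?A = "\<lambda>c. pw (int t + 2 - 2 * int c)"
  let ?d = "\<lambda>c. e c * E (n - c) z - e (n - c) * E c z"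
  have "collapse (Phi b t) z = (\<Sum>c=1..Suc t.
      of_int (?u c) * ((of_nat (n - c) * e (n - c) - z * E (n - c) z) * E c z)
    + of_int (?v c) * ((of_nat c * e c - z * E c z) * E (n - c) z))"
    by (simp only: Phi_def[abs_def] collapse_sum collapse_add collapse_E_E n)
  also have "\<dots> = (\<Sum>c=1..Suc t.
      of_int (?A c - ?A (Suc c)) * (E c z * E (Suc n - c) z) + of_int (pw (int t + 1 - 2 * int c)) * ?d c
      + of_int (?u c * (int b + int t - int c)) * (e (n - c) * E c z)
      + of_int (?v c * (int c - 1)) * (e c * E (n - c) z) - of_int (?A (Suc c)) * ?d c)"
  proof (rule sum.cong)
    fix c assume c: "c \<in> {1..Suc t}"
    have a: "of_nat (n - c) = of_int (int b + int t - int c) + (1::'r)"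
      using c n by (simp add: of_nat_diff)
    have b': "of_nat c = of_int (int c - 1) + (1::'r)" by simp
    have E1: "z * E c z * E (n - c) z = e c * E (n - c) z - E (Suc c) z * E (n - c) z"
      and E2: "z * E (n - c) z * E c z = e (n - c) * E c z - E (Suc n - c) z * E c z"
      using c n by (simp_all add: algebra_simps Suc_diff_le)
    \<comment> \<open>The second family of \<open>Phi\<close> produces the neighbouring product;
      rewriting it as that of the first family costs \<open>?d c\<close>.\<close>
    have E3: "E (Suc c) z * E (n - c) z = E c z * E (Suc n - c) z + ?d c"
    proof -
      have "Suc n - c = Suc (n - c)" using c n by (simp add: Suc_diff_le)
      then show ?thesis
        unfolding E_mult_exchange[of c z "n - c", symmetric] by (simp del: E.simps)
    qed
    \<comment> \<open>The sum of both weights is \<open>?A c - ?A (Suc c)\<close>, as Abel summation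
      wants. The part \<open>?A (Suc c)\<close> subtracted in the second weight, times
      \<open>?d c\<close>, later cancels against the correction of
      \<open>abel_sum_E\<close>.\<close>
    have w: "?u c = ?A c - pw (int t + 1 - 2 * int c)" "?v c = pw (int t + 1 - 2 * int c) - ?A (Suc c)"
      by (simp_all add: dpw_def algebra_simps)
    have "of_int (?u c) * ((of_nat (n - c) * e (n - c) - z * E (n - c) z) * E c z)
      + of_int (?v c) * ((of_nat c * e c - z * E c z) * E (n - c) z)
      = of_int (?u c * (int b + int t - int c)) * (e (n - c) * E c z)
      + of_int (?v c * (int c - 1)) * (e c * E (n - c) z)
      + of_int (?u c) * (e (n - c) * E c z - z * E (n - c) z * E c z)
      + of_int (?v c) * (e c * E (n - c) z - z * E c z * E (n - c) z)"
      unfolding a b' of_int_mult by (simp add: algebra_simps del: E.simps)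
    also have "\<dots> = of_int (?u c * (int b + int t - int c)) * (e (n - c) * E c z)
      + of_int (?v c * (int c - 1)) * (e c * E (n - c) z)
      + of_int (?u c) * (E c z * E (Suc n - c) z)
      + of_int (?v c) * (E c z * E (Suc n - c) z + ?d c)"
      unfolding E1 E2 E3 by (simp add: algebra_simps del: E.simps)
    also have "\<dots> = of_int (?A c - ?A (Suc c)) * (E c z * E (Suc n - c) z)
      + of_int (pw (int t + 1 - 2 * int c)) * ?d c
      + of_int (?u c * (int b + int t - int c)) * (e (n - c) * E c z)
      + of_int (?v c * (int c - 1)) * (e c * E (n - c) z) - of_int (?A (Suc c)) * ?d c"
      unfolding w by (simp add: algebra_simps del: E.simps)
    finally show "of_int (?u c) * ((of_nat (n - c) * e (n - c) - z * E (n - c) z) * E c z)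
      + of_int (?v c) * ((of_nat c * e c - z * E c z) * E (n - c) z) = \<dots>" .
  qed simp
  also have "\<dots> = (\<Sum>c=1..Suc t. of_int (?A c - ?A (Suc c)) * (E c z * E (Suc n - c) z))
      + (\<Sum>c=1..Suc t. of_int (pw (int t + 1 - 2 * int c)) * ?d c
      + of_int (?u c * (int b + int t - int c)) * (e (n - c) * E c z)
      + of_int (?v c * (int c - 1)) * (e c * E (n - c) z)) - (\<Sum>c=1..Suc t. of_int (?A (Suc c)) * ?d c)"
    by (simp only: sum.distrib sum_subtractf add.assoc)
  also have "(\<Sum>c=1..Suc t. of_int (?A c - ?A (Suc c)) * (E c z * E (Suc n - c) z))
      = of_int (pw (int t)) * E n z + (\<Sum>c=1..Suc t. of_int (?A (Suc c)) * ?d c)"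
  proof -
    have "Suc t \<le> n" using n by simp
    \<comment> \<open>The boundary term carries \<open>pw\<close> at the index -t - 2 and
      vanishes.\<close>
    from abel_sum_E[OF this, of ?A z] show ?thesis by (simp add: pw_neg del: E.simps)
  qed
  also have "(\<Sum>c=1..Suc t. of_int (pw (int t + 1 - 2 * int c)) * ?d c
      + of_int (?u c * (int b + int t - int c)) * (e (n - c) * E c z)
      + of_int (?v c * (int c - 1)) * (e c * E (n - c) z))
     = (\<Sum>c=1..Suc t. of_int (Phi_coeff1 b t c + ?u c) * (e (n - c) * E c z)
        + of_int (Phi_coeff2 t c + ?v c) * (e c * E (n - c) z))"
    by (intro sum.cong) (simp_all add: Phi_coeff1_def Phi_coeff2_def algebra_simps del: E.simps)
  finally show ?thesis by (simp add: algebra_simps del: E.simps)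
qed

text \<open>The two families of \<open>Phi\<close> exchange roles as t grows:
  \<open>- w * E i w = E (i + 1) w - e i\<close> turns the first family at t into the second at t +
  1, and the second, shifted by one in c, into the first. The missing term c = 1, of weight
  \<open>dpw (t + 1) = pw t\<close>, is exactly the leading term of
  \<open>collapse_Phi\<close>.\<close>

lemma extend_Phi:
  assumes n: "n = b + t + 1" and b: "1 \<le> b"
  shows "extend (Phi b t) z w = Phi b (Suc t) z w
    + (\<Sum>c=1..Suc t. of_int (Phi_coeff1 b t c) * (e (n - c) * E c z) + of_int (Phi_coeff2 t c) * (e c * E (n - c) z))"
proof -
  let ?u = "\<lambda>c. dpw (int t + 2 - 2 * int c)" and ?v = "\<lambda>c. dpw (int t + 1 - 2 * int c)"
  have 1: "- w * Phi b t w z = (\<Sum>c=1..Suc t.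
      of_int (?u c) * (E c z * E (Suc n - c) w) + of_int (?v c) * (E (n - c) z * E (Suc c) w))
    - (\<Sum>c=1..Suc t. of_int (?u c) * (e (n - c) * E c z) + of_int (?v c) * (e c * E (n - c) z))"
    unfolding Phi_def n[symmetric] sum_distrib_left sum_subtractf[symmetric]
  proof (rule sum.cong)
    fix c assume c: "c \<in> {1..Suc t}"
    have "E (Suc n - c) w = e (n - c) - w * E (n - c) w"
      using c n by (simp add: Suc_diff_le)
    show "- w * (of_int (?u c) * (E (n - c) w * E c z) + of_int (?v c) * (E c w * E (n - c) z))
      = of_int (?u c) * (E c z * E (Suc n - c) w) + of_int (?v c) * (E (n - c) z * E (Suc c) w)
      - (of_int (?u c) * (e (n - c) * E c z) + of_int (?v c) * (e c * E (n - c) z))"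
      unfolding \<open>E (Suc n - c) w = _\<close> by (simp add: algebra_simps)
  qed simp
  have sa: "(\<Sum>c=1..Suc (Suc t). of_int (dpw (int (Suc t) + 2 - 2 * int c)) * (E (Suc n - c) z * E c w))
     = of_int (pw (int t)) * E n z
       + (\<Sum>c=1..Suc t. of_int (?v c) * (E (n - c) z * E (Suc c) w))"
  proof -
    have "(\<Sum>c=1..Suc (Suc t). of_int (dpw (int (Suc t) + 2 - 2 * int c)) * (E (Suc n - c) z * E c w))
      = of_int (dpw (int (Suc t))) * (E n z * E (Suc 0) w)
       + (\<Sum>c=Suc 1..Suc (Suc t). of_int (dpw (int (Suc t) + 2 - 2 * int c)) * (E (Suc n - c) z * E c w))"
      by (subst sum.atLeast_Suc_atMost) (simp_all del: E.simps)
    also have "(\<Sum>c=Suc 1..Suc (Suc t). of_int (dpw (int (Suc t) + 2 - 2 * int c)) * (E (Suc n - c) z * E c w))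
       = (\<Sum>c=1..Suc t. of_int (dpw (int (Suc t) + 2 - 2 * int (Suc c))) * (E (Suc n - Suc c) z * E (Suc c) w))"
      by (rule sum.shift_bounds_cl_Suc_ivl)
    finally show ?thesis
      by (simp add: dpw_pos e_0 algebra_simps)
  qed
  have sb: "(\<Sum>c=1..Suc (Suc t). of_int (dpw (int (Suc t) + 1 - 2 * int c)) * (E c z * E (Suc n - c) w))
     = (\<Sum>c=1..Suc t. of_int (?u c) * (E c z * E (Suc n - c) w))"
    by (subst sum.cl_ivl_Suc) (simp add: dpw_neg algebra_simps del: E.simps)
  have "Phi b (Suc t) z w = of_int (pw (int t)) * E n z + (\<Sum>c=1..Suc t.
      of_int (?u c) * (E c z * E (Suc n - c) w) + of_int (?v c) * (E (n - c) z * E (Suc c) w))"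
    using sa sb by (simp add: Phi_def n sum.distrib algebra_simps del: E.simps sum.cl_ivl_Suc)
  then show ?thesis
    unfolding extend_def collapse_Phi[OF n b]
    using 1 by (simp add: sum.distrib algebra_simps del: E.simps sum.cl_ivl_Suc)
qed

subsection \<open>The positive cones\<close>

inductive epos :: "nat \<Rightarrow> 'r \<Rightarrow> bool" where
  epos_0: "epos d 0"
| epos_1: "epos 0 1"
| epos_add: "epos d r \<Longrightarrow> epos d s \<Longrightarrow> epos d (r + s)"
| epos_scale: "0 \<le> c \<Longrightarrow> epos d r \<Longrightarrow> epos d (cst c * r)"
| epos_e: "epos d r \<Longrightarrow> epos (d + j) (e j * r)"

inductive pos1 :: "nat \<Rightarrow> ('r \<Rightarrow> 'r) \<Rightarrow> bool" where
  pos1_0: "pos1 n (\<lambda>z. 0)"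
| pos1_add: "pos1 n f \<Longrightarrow> pos1 n g \<Longrightarrow> pos1 n (\<lambda>z. f z + g z)"
| pos1_E: "epos d r \<Longrightarrow> 1 \<le> k \<Longrightarrow> pos1 (d + k) (\<lambda>z. r * E k z)"

text \<open>The index is the number of vertices, two more than the degree in the letters. Bundles
  start at b = 2, since the one for b = 1 has a negative correction term; the \<open>D j\<close>
  replace it.\<close>

inductive pos2 :: "nat \<Rightarrow> ('r \<Rightarrow> 'r \<Rightarrow> 'r) \<Rightarrow> bool" where
  pos2_0: "pos2 n (\<lambda>y z. 0)"
| pos2_add: "pos2 n f \<Longrightarrow> pos2 n g \<Longrightarrow> pos2 n (\<lambda>y z. f y z + g y z)"
| pos2_Phi: "epos d r \<Longrightarrow> 2 \<le> b \<Longrightarrow> pos2 (d + (b + t + 1)) (\<lambda>y z. r * Phi b t y z)"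
| pos2_D: "epos d r \<Longrightarrow> 2 \<le> j \<Longrightarrow> pos2 (d + j) (\<lambda>y z. r * D j y z)"

lemma epos_of_nat: "epos d r \<Longrightarrow> epos d (of_nat k * r)"
  using epos_scale[of "of_nat k" d r] by (simp add: cst_of_nat)

lemma epos_of_int: "0 \<le> k \<Longrightarrow> epos d r \<Longrightarrow> epos d (of_int k * r)"
  using epos_of_nat[of d r "nat k"] by simp

lemma epos_of_int_e: "0 \<le> k \<Longrightarrow> epos d r \<Longrightarrow> epos (d + j) (r * (of_int k * e j))"
  using epos_of_int[OF _ epos_e, of k d r j] by (simp add: mult_ac)

lemma pos1_sum:
  "finite A \<Longrightarrow> (\<And>c. c \<in> A \<Longrightarrow> pos1 n (f c)) \<Longrightarrow> pos1 n (\<lambda>z. \<Sum>c\<in>A. f c z)"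
proof (induction A rule: finite_induct)
  case empty
  then show ?case by (simp add: pos1_0)
next
  case (insert a A)
  then show ?case by (simp add: pos1_add)
qed

lemma pos2_sum:
  "finite A \<Longrightarrow> (\<And>c. c \<in> A \<Longrightarrow> pos2 n (f c)) \<Longrightarrow> pos2 n (\<lambda>y z. \<Sum>c\<in>A. f c y z)"
proof (induction A rule: finite_induct)
  case empty
  then show ?case by (simp add: pos2_0)
next
  case (insert a A)
  then show ?case by (simp add: pos2_add)
qed

text \<open>The start k = 1 is \<open>D 2\<close>, any other start is the bundle with t = 0.\<close>

lemma pos2_E:
  assumes "epos d r" "1 \<le> k"
  shows "pos2 (Suc (d + k)) (\<lambda>y z. r * E k y)"
proof (cases "k = 1")
  case True
  then show ?thesis
    using pos2_D[OF assms(1), of 2] by (simp add: D_2 e_0)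
next
  case False
  then show ?thesis
    using pos2_Phi[OF assms(1), of k 0] assms(2) by (simp add: Phi_0)
qed

text \<open>Models a vertex joined to the last one only: the function does not see the new colour,
  and that the two colours differ is recorded separately by the indicator in
  \<open>pair_positive\<close>.\<close>

lemma pos2_of_pos1: "pos1 n f \<Longrightarrow> pos2 (Suc n) (\<lambda>y z. f y)"
  by (induction rule: pos1.induct) (auto intro: pos2_0 pos2_add pos2_E)

lemma pos1_collapse: "pos2 n f \<Longrightarrow> pos1 n (collapse f)"
proof (induction rule: pos2.induct)
  case (pos2_0 n)
  then show ?case by (simp add: collapse_0 pos1_0)
next
  case (pos2_add n f g)
  then show ?case by (simp add: collapse_add pos1_add)
next
  case (pos2_Phi d r b t)
  let ?n = "b + t + 1"
  let ?f = "\<lambda>c. Phi_coeff1 b t c + dpw (int t + 2 - 2 * int c)"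
  let ?g = "\<lambda>c. Phi_coeff2 t c + dpw (int t + 1 - 2 * int c)"
  have eq: "collapse (\<lambda>y z. r * Phi b t y z) = (\<lambda>z. (of_int (pw (int t)) * r) * E ?n z
    + (\<Sum>c=1..Suc t. (r * (of_int (?f c) * e (?n - c))) * E c z
        + (r * (of_int (?g c) * e c)) * E (?n - c) z))"
    using pos2_Phi.hyps
    by (simp add: collapse_cmult collapse_Phi[OF refl] distrib_left sum_distrib_left mult.assoc
        mult.left_commute del: E.simps sum.cl_ivl_Suc)
  show ?case unfolding eq
  proof (intro pos1_add pos1_sum)
    show "pos1 (d + ?n) (\<lambda>z. of_int (pw (int t)) * r * E ?n z)"
      by (intro pos1_E epos_of_int pos2_Phi pw_nonneg) simp
    fix c assume c: "c \<in> {1..Suc t}"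
    have "pos1 (d + (?n - c) + c) (\<lambda>z. r * (of_int (?f c) * e (?n - c)) * E c z)"
      using c pos2_Phi.hyps by (intro pos1_E epos_of_int_e pos2_Phi add_nonneg_nonneg Phi_coeff1_nonneg dpw_nonneg) auto
    moreover have "pos1 (d + c + (?n - c)) (\<lambda>z. r * (of_int (?g c) * e c) * E (?n - c) z)"
      using c pos2_Phi.hyps by (intro pos1_E epos_of_int_e pos2_Phi add_nonneg_nonneg Phi_coeff2_nonneg dpw_nonneg) auto
    moreover have "d + (?n - c) + c = d + ?n" "d + c + (?n - c) = d + ?n" using c by auto
    ultimately show "pos1 (d + ?n) (\<lambda>z. r * (of_int (?f c) * e (?n - c)) * E c z)"
      "pos1 (d + ?n) (\<lambda>z. r * (of_int (?g c) * e c) * E (?n - c) z)" by simp_all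
  qed simp
next
  case (pos2_D d r j)
  then obtain k where k: "j = Suc k" by (cases j) auto
  have "collapse (\<lambda>y z. r * D j y z) = (\<lambda>z. (of_nat k * r) * E j z)"
    unfolding k by (simp add: collapse_cmult collapse_D mult.assoc mult.left_commute del: D.simps E.simps)
  then show ?case
    using pos2_D by (simp add: pos1_E epos_of_nat)
qed

lemma pos2_extend: "pos2 n f \<Longrightarrow> pos2 (Suc n) (extend f)"
proof (induction rule: pos2.induct)
  case (pos2_0 n)
  then show ?case by (simp add: extend_0 pos2.pos2_0)
next
  case (pos2_add n f g)
  then show ?case by (simp add: extend_add pos2.pos2_add)
next
  case (pos2_Phi d r b t)
  let ?n = "b + t + 1"
  have eq: "extend (\<lambda>y z. r * Phi b t y z) = (\<lambda>z w. r * Phi b (Suc t) z w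
    + (\<Sum>c=1..Suc t. (r * (of_int (Phi_coeff1 b t c) * e (?n - c))) * E c z
        + (r * (of_int (Phi_coeff2 t c) * e c)) * E (?n - c) z))"
    using pos2_Phi.hyps
    by (simp add: extend_cmult extend_Phi[OF refl] distrib_left sum_distrib_left mult.assoc
        mult.left_commute del: E.simps sum.cl_ivl_Suc)
  show ?case unfolding eq
  proof (intro pos2.pos2_add pos2_sum)
    show "pos2 (Suc (d + ?n)) (\<lambda>z w. r * Phi b (Suc t) z w)"
      using pos2.pos2_Phi[OF pos2_Phi.hyps(1,2), of "Suc t"] by simp
    fix c assume c: "c \<in> {1..Suc t}"
    have "pos2 (Suc (d + (?n - c) + c)) (\<lambda>z w. r * (of_int (Phi_coeff1 b t c) * e (?n - c)) * E c z)"
      using c pos2_Phi.hyps by (intro pos2_E epos_of_int_e pos2_Phi Phi_coeff1_nonneg) auto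
    moreover have "pos2 (Suc (d + c + (?n - c))) (\<lambda>z w. r * (of_int (Phi_coeff2 t c) * e c) * E (?n - c) z)"
      using c pos2_Phi.hyps by (intro pos2_E epos_of_int_e pos2_Phi Phi_coeff2_nonneg) auto
    moreover have "d + (?n - c) + c = d + ?n" "d + c + (?n - c) = d + ?n" using c by auto
    ultimately show "pos2 (Suc (d + ?n)) (\<lambda>z w. r * (of_int (Phi_coeff1 b t c) * e (?n - c)) * E c z)"
      "pos2 (Suc (d + ?n)) (\<lambda>z w. r * (of_int (Phi_coeff2 t c) * e c) * E (?n - c) z)" by simp_all
  qed simp
next
  case (pos2_D d r j)
  then obtain k where k: "j = Suc (Suc k)" by (cases j; cases "j - 1") auto
  have eq: "extend (\<lambda>y z. r * D j y z) = (\<lambda>z w. (of_nat k * r) * E j z + r * D (Suc j) z w)"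
    unfolding k by (simp add: extend_cmult extend_D algebra_simps del: D.simps E.simps)
  show ?case unfolding eq
    using pos2_D pos2.pos2_D[of d r "Suc j"] by (intro pos2.pos2_add pos2_E epos_of_nat) auto
qed

text \<open>The two subtracted terms are those with y = z (inside \<open>collapse\<close>) and y =
  w, the colours barred by the neighbours.\<close>

lemma extend_at_letters:
  assumes "z \<in> C" "w \<in> C" "z \<noteq> w"
  shows "extend f (x z) (x w) = (\<Sum>y\<in>C - {z, w}. x y * f (x y) (x z))"
proof -
  have "(\<Sum>y\<in>C. x y * f (x y) (x z)) = x z * f (x z) (x z) + (x w * f (x w) (x z)
     + (\<Sum>y\<in>C - {z, w}. x y * f (x y) (x z)))"
    using assms fin by (simp add: sum.remove[of C z] sum.remove[of "C - {z}" w] insert_commute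
        flip: Diff_insert2)
  then show ?thesis by (simp add: extend_def collapse_def tr_def)
qed

lemma collapse_at_letter:
  assumes "z \<in> C"
  shows "collapse f (x z) = (\<Sum>y\<in>C - {z}. x y * f (x y) (x z))"
  using assms fin by (simp add: collapse_def tr_def sum.remove[of C z])

end

section \<open>The functions \<open>e_basis \<pi>\<close> form a basis\<close>

text \<open>An arbitrary vertex set \<open>A\<close> is allowed so that spans on disjoint sets can
  be multiplied.\<close>

definition espan :: "nat set \<Rightarrow> ((nat \<Rightarrow> nat) \<Rightarrow> real) \<Rightarrow> bool" where
  "espan A f \<longleftrightarrow> (\<exists>c. \<forall>\<kappa>. f \<kappa> = (\<Sum>\<pi> | partition_on A \<pi>. c \<pi> * e_basis \<pi> \<kappa>))"

lemma espan_add: "espan A f \<Longrightarrow> espan A g \<Longrightarrow> espan A (\<lambda>\<kappa>. f \<kappa> + g \<kappa>)"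
  unfolding espan_def
proof (elim exE)
  fix c d
  assume "\<forall>\<kappa>. f \<kappa> = (\<Sum>\<pi> | partition_on A \<pi>. c \<pi> * e_basis \<pi> \<kappa>)"
    and "\<forall>\<kappa>. g \<kappa> = (\<Sum>\<pi> | partition_on A \<pi>. d \<pi> * e_basis \<pi> \<kappa>)"
  then show "\<exists>c. \<forall>\<kappa>. f \<kappa> + g \<kappa> = (\<Sum>\<pi> | partition_on A \<pi>. c \<pi> * e_basis \<pi> \<kappa>)"
    by (intro exI[of _ "\<lambda>\<pi>. c \<pi> + d \<pi>"]) (simp add: sum.distrib distrib_right)
qed

lemma espan_scale: "espan A f \<Longrightarrow> espan A (\<lambda>\<kappa>. r * f \<kappa>)"
  unfolding espan_def
proof (elim exE)
  fix c
  assume "\<forall>\<kappa>. f \<kappa> = (\<Sum>\<pi> | partition_on A \<pi>. c \<pi> * e_basis \<pi> \<kappa>)"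
  then show "\<exists>c. \<forall>\<kappa>. r * f \<kappa> = (\<Sum>\<pi> | partition_on A \<pi>. c \<pi> * e_basis \<pi> \<kappa>)"
    by (intro exI[of _ "\<lambda>\<pi>. r * c \<pi>"]) (simp add: sum_distrib_left mult.assoc)
qed

lemma espan_0: "espan A (\<lambda>\<kappa>. 0)"
  unfolding espan_def by (rule exI[of _ "\<lambda>\<pi>. 0"]) simp

lemma espan_sum: "(\<And>i. i \<in> I \<Longrightarrow> espan A (f i)) \<Longrightarrow> espan A (\<lambda>\<kappa>. \<Sum>i\<in>I. f i \<kappa>)"
  by (induction I rule: infinite_finite_induct) (auto intro: espan_0 espan_add)

lemma espan_e_basis:
  assumes "finite A" "partition_on A \<pi>"
  shows "espan A (e_basis \<pi>)"
  unfolding espan_def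
proof (intro exI allI)
  fix \<kappa>
  have "(\<Sum>\<sigma> | partition_on A \<sigma>. of_bool (\<sigma> = \<pi>) * e_basis \<sigma> \<kappa>)
      = (\<Sum>\<sigma> | partition_on A \<sigma>. if \<sigma> = \<pi> then e_basis \<pi> \<kappa> else 0)"
    by (intro sum.cong) auto
  then show "e_basis \<pi> \<kappa> = (\<Sum>\<sigma> | partition_on A \<sigma>. of_bool (\<sigma> = \<pi>) * e_basis \<sigma> \<kappa>)"
    using assms by (simp add: finitely_many_partition_on)
qed

lemma partition_on_Un:
  assumes "partition_on A \<pi>" "partition_on B \<sigma>" "A \<inter> B = {}"
  shows "partition_on (A \<union> B) (\<pi> \<union> \<sigma>)"
proof -
  have "disjoint (\<pi> \<union> \<sigma>)"
    using assms by (intro disjoint_union) (auto simp: partition_on_def)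
  then show ?thesis
    using assms by (auto simp: partition_on_def)
qed

lemma espan_mult:
  assumes "finite A" "finite B" "A \<inter> B = {}" "espan A f" "espan B g"
  shows "espan (A \<union> B) (\<lambda>\<kappa>. f \<kappa> * g \<kappa>)"
proof -
  obtain c d where c: "\<And>\<kappa>. f \<kappa> = (\<Sum>\<pi> | partition_on A \<pi>. c \<pi> * e_basis \<pi> \<kappa>)"
    and d: "\<And>\<kappa>. g \<kappa> = (\<Sum>\<pi> | partition_on B \<pi>. d \<pi> * e_basis \<pi> \<kappa>)"
    using assms unfolding espan_def by blast
  have m: "e_basis \<pi> \<kappa> * e_basis \<sigma> \<kappa> = e_basis (\<pi> \<union> \<sigma>) \<kappa>" for \<pi> \<sigma> \<kappa>
    by (auto simp: e_basis_def)
  have eq: "(\<lambda>\<kappa>. f \<kappa> * g \<kappa>) = (\<lambda>\<kappa>. \<Sum>\<pi> | partition_on A \<pi>. \<Sum>\<sigma> | partition_on B \<sigma>.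
      (c \<pi> * d \<sigma>) * e_basis (\<pi> \<union> \<sigma>) \<kappa>)"
    by (simp add: c d sum_product m[symmetric] mult_ac)
  show ?thesis
    unfolding eq using assms by (intro espan_sum espan_scale espan_e_basis) (auto intro: partition_on_Un)
qed

definition constant_on_set :: "(nat \<Rightarrow> nat) \<Rightarrow> nat set \<Rightarrow> bool" where
  "constant_on_set \<kappa> B \<longleftrightarrow> (\<forall>i\<in>B. \<forall>j\<in>B. \<kappa> i = \<kappa> j)"

text \<open>Only \<open>C = K\<close>, the colour class of the pivot \<open>p\<close>, and \<open>C = K - {s}\<close> contribute to the sum,
  and these terms cancel unless \<open>K = {p}\<close>.\<close>

lemma inj_on_pivot_expansion:
  assumes "finite B" "p \<in> B"
  shows "(of_bool (inj_on \<kappa> B) :: real) = (\<Sum>C | p \<in> C \<and> C \<subseteq> B.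
    (-1) ^ (card C - 1) * fact (card C - 1) * (of_bool (inj_on \<kappa> (B - C)) * of_bool (constant_on_set \<kappa> C)))"
    (is "_ = (\<Sum>C | _. ?t C)")
proof -
  define K where "K = {s \<in> B. \<kappa> s = \<kappa> p}"
  have K: "p \<in> K" "K \<subseteq> B" "finite K" "constant_on_set \<kappa> K"
    using assms by (auto simp: K_def constant_on_set_def)
  have CK: "C \<subseteq> K" if "p \<in> C" "C \<subseteq> B" "constant_on_set \<kappa> C" for C
  proof
    fix i assume "i \<in> C"
    then have "i \<in> B" "\<kappa> i = \<kappa> p" using that unfolding constant_on_set_def by blast+
    then show "i \<in> K" by (simp add: K_def)
  qed
  show ?thesis
  proof (cases "inj_on \<kappa> (B - K)")
    case False
    have t0: "?t C = 0" if "p \<in> C \<and> C \<subseteq> B" for C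
    proof -
      have "\<not> inj_on \<kappa> (B - C)" if "constant_on_set \<kappa> C"
        using CK[of C] that \<open>p \<in> C \<and> C \<subseteq> B\<close> False inj_on_subset[of \<kappa> "B - C" "B - K"] by blast
      then show ?thesis by auto
    qed
    have "(\<Sum>C | p \<in> C \<and> C \<subseteq> B. ?t C) = 0"
      by (rule sum.neutral, rule ballI, rule t0) simp
    moreover have "\<not> inj_on \<kappa> B" using False inj_on_subset by blast
    ultimately show ?thesis by (simp only: of_bool_eq)
  next
    case True
    let ?T = "insert K ((\<lambda>s. K - {s}) ` (K - {p}))"
    let ?k = "card K"
    have zero: "?t C = 0" if C: "p \<in> C" "C \<subseteq> B" "C \<notin> ?T" for C
    proof (rule ccontr)
      assume "?t C \<noteq> 0"
      then have i: "inj_on \<kappa> (B - C)" and "constant_on_set \<kappa> C"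
        by (auto split: if_splits)
      then have "C \<subset> K" using CK C by blast
      then obtain s where s: "s \<in> K" "s \<notin> C" by blast
      then have "C \<noteq> K - {s}" using C by blast
      then obtain s' where s': "s' \<in> K" "s' \<notin> C" "s' \<noteq> s" using s \<open>C \<subset> K\<close> by blast
      have "\<kappa> s = \<kappa> s'" "s \<in> B - C" "s' \<in> B - C" using s s' by (auto simp: K_def)
      then show False using i s'(3) by (auto dest: inj_onD)
    qed
    have tK: "?t K = (-1) ^ (?k - 1) * fact (?k - 1)"
      using True K by simp
    have ts: "?t (K - {s}) = (-1) ^ (?k - 2) * fact (?k - 2)" if s: "s \<in> K - {p}" for s
    proof -
      have "inj_on \<kappa> (B - (K - {s}))"
      proof (rule inj_onI)
        fix i j assume ij: "i \<in> B - (K - {s})" "j \<in> B - (K - {s})" "\<kappa> i = \<kappa> j"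
        show "i = j"
        proof (cases "\<kappa> i = \<kappa> p")
          case True
          then have "i \<in> K" "j \<in> K" using ij by (auto simp: K_def)
          then show ?thesis using ij by auto
        next
          case F: False
          then have "i \<in> B - K" "j \<in> B - K" using ij by (auto simp: K_def)
          then show ?thesis using True ij(3) by (auto dest: inj_onD)
        qed
      qed
      moreover have "constant_on_set \<kappa> (K - {s})" using K(4) by (auto simp: constant_on_set_def)
      moreover have "card (K - {s}) = ?k - 1" using s K(3) by simp
      ultimately show ?thesis by (simp add: numeral_2_eq_2)
    qed
    have "(\<Sum>C | p \<in> C \<and> C \<subseteq> B. ?t C) = sum ?t ?T"
    proof (rule sum.mono_neutral_right)
      show "finite {C. p \<in> C \<and> C \<subseteq> B}" using assms by simp
      show "?T \<subseteq> {C. p \<in> C \<and> C \<subseteq> B}" using K by auto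
      show "\<forall>C\<in>{C. p \<in> C \<and> C \<subseteq> B} - ?T. ?t C = 0" using zero by blast
    qed
    also have "\<dots> = ?t K + sum ?t ((\<lambda>s. K - {s}) ` (K - {p}))"
      using K by (intro sum.insert) auto
    also have "sum ?t ((\<lambda>s. K - {s}) ` (K - {p})) = (\<Sum>s\<in>K - {p}. ?t (K - {s}))"
      by (subst sum.reindex) (auto simp: inj_on_def)
    also have "\<dots> = (\<Sum>s\<in>K - {p}. (-1) ^ (?k - 2) * fact (?k - 2))"
      by (intro sum.cong refl ts)
    also have "\<dots> = of_nat (?k - 1) * ((-1) ^ (?k - 2) * fact (?k - 2))"
      using K by simp
    \<comment> \<open>For \<open>?k\<close> at least 2 the \<open>?k - 1\<close> equal terms add up
      to the negative of \<open>?t K\<close>, as (k - 1) * (k - 2)! = (k - 1)! with opposite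
      sign.\<close>
    also have "?t K + \<dots> = of_bool (inj_on \<kappa> B)"
    proof (cases "?k = 1")
      case k: True
      then have "K = {p}" using K by (auto simp: card_1_singleton_iff)
      have "inj_on \<kappa> B"
      proof (rule inj_onI)
        fix i j assume ij: "i \<in> B" "j \<in> B" "\<kappa> i = \<kappa> j"
        show "i = j"
        proof (cases "\<kappa> i = \<kappa> p")
          case T: True
          then have "i \<in> K" "j \<in> K" using ij by (auto simp: K_def)
          then show ?thesis using \<open>K = {p}\<close> by auto
        next
          case F: False
          then have "i \<in> B - K" "j \<in> B - K" using ij by (auto simp: K_def)
          then show ?thesis using True ij(3) by (auto dest: inj_onD)
        qed
      qed
      then show ?thesis using True K(4) k by simp
    next
      case False
      have "?k > 0" using K card_gt_0_iff by blast
      then obtain m where m: "?k = Suc (Suc m)" using False by (metis One_nat_def not0_implies_Suc not_gr_zero)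
      have "K \<noteq> {p}" using m by auto
      then obtain s where "s \<in> K" "s \<noteq> p" using K by blast
      then have "\<not> inj_on \<kappa> B" using K by (auto simp: K_def inj_on_def)
      then show ?thesis using True K(4) m by (simp add: algebra_simps)
    qed
    finally show ?thesis by simp
  qed
qed

lemma espan_inj_on:
  assumes "finite B"
  shows "espan B (\<lambda>\<kappa>. of_bool (inj_on \<kappa> B))"
proof (cases "B = {}")
  case True
  have "e_basis {} = (\<lambda>\<kappa>. 1)" by (simp add: e_basis_def fun_eq_iff)
  then show ?thesis using espan_e_basis[of "{}" "{}"] True by (simp add: partition_on_empty)
next
  case False
  have "e_basis {B} = (\<lambda>\<kappa>. of_bool (inj_on \<kappa> B))" by (simp add: e_basis_def fun_eq_iff)
  then show ?thesis using espan_e_basis[OF assms partition_on_space[OF False]] by simp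
qed

text \<open>The pivot expansion is solved for its term C = B, whose coefficient is nonzero. Every
  other term is a product over the disjoint sets \<open>B - C\<close> and \<open>C\<close>, with
  \<open>C\<close> smaller than \<open>B\<close>.\<close>

lemma espan_constant_on_set:
  assumes "finite B" "B \<noteq> {}"
  shows "espan B (\<lambda>\<kappa>. of_bool (constant_on_set \<kappa> B))"
  using assms
proof (induction "card B" arbitrary: B rule: less_induct)
  case less
  then obtain p where p: "p \<in> B" by blast
  let ?a = "\<lambda>C. (-1) ^ (card C - 1) * fact (card C - 1) :: real"
  let ?t = "\<lambda>C \<kappa>. of_bool (inj_on \<kappa> (B - C)) * of_bool (constant_on_set \<kappa> C) :: real"
  let ?S = "{C. p \<in> C \<and> C \<subseteq> B} - {B}"
  have eq: "of_bool (constant_on_set \<kappa> B)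
      = (1 / ?a B) * (of_bool (inj_on \<kappa> B) + (-1) * (\<Sum>C\<in>?S. ?a C * ?t C \<kappa>))" for \<kappa>
  proof -
    have "of_bool (inj_on \<kappa> B) = ?a B * ?t B \<kappa> + (\<Sum>C\<in>?S. ?a C * ?t C \<kappa>)"
      unfolding inj_on_pivot_expansion[OF less.prems(1) p]
      by (rule sum.remove) (use less.prems p in auto)
    then show ?thesis by (simp add: field_simps)
  qed
  have "espan B (?t C)" if "C \<in> ?S" for C
  proof -
    have C: "finite C" "C \<noteq> {}" "C \<subset> B" using that less.prems by (auto intro: finite_subset)
    have "espan ((B - C) \<union> C) (?t C)"
      using C less.prems by (intro espan_mult espan_inj_on less.hyps psubset_card_mono) auto
    then show ?thesis using C by (simp add: Un_absorb2)
  qed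
  then show ?case
    unfolding eq by (intro espan_scale espan_add espan_sum espan_inj_on less.prems)
qed

lemma espan_constant_on_blocks:
  assumes "finite \<tau>" "disjoint \<tau>" "\<And>B. B \<in> \<tau> \<Longrightarrow> finite B \<and> B \<noteq> {}"
  shows "espan (\<Union>\<tau>) (\<lambda>\<kappa>. of_bool (\<forall>B\<in>\<tau>. constant_on_set \<kappa> B))"
  using assms
proof (induction \<tau> rule: finite_induct)
  case empty
  then show ?case using espan_inj_on[of "{}"] by simp
next
  case (insert B \<tau>)
  have "B \<inter> \<Union>\<tau> = {}"
    using insert by (auto simp: disjoint_def)
  then have "espan (B \<union> \<Union>\<tau>) (\<lambda>\<kappa>. of_bool (constant_on_set \<kappa> B) * of_bool (\<forall>B\<in>\<tau>. constant_on_set \<kappa> B))"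
    using insert by (intro espan_mult espan_constant_on_set) (auto simp: disjoint_def)
  then show ?case by (simp add: of_bool_conj)
qed

section \<open>Words and the partitions into their colour classes\<close>

definition kernel_partition :: "nat set \<Rightarrow> (nat \<Rightarrow> nat) \<Rightarrow> nat set set" where
  "kernel_partition A \<kappa> = (\<lambda>i. {j \<in> A. \<kappa> j = \<kappa> i}) ` A"

lemma partition_on_kernel: "partition_on A (kernel_partition A \<kappa>)"
  by (rule partition_onI) (auto simp: kernel_partition_def disjnt_def)

lemma kernel_partition_eq_iff:
  assumes "i \<in> A" "j \<in> A"
  shows "\<kappa> i = \<kappa> j \<longleftrightarrow> (\<exists>C\<in>kernel_partition A \<kappa>. i \<in> C \<and> j \<in> C)"
  using assms by (auto simp: kernel_partition_def)

lemma constant_on_blocks_iff: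
  assumes "partition_on A \<tau>"
  shows "(\<forall>B\<in>\<tau>. constant_on_set \<kappa> B) \<longleftrightarrow> refines A \<tau> (kernel_partition A \<kappa>)"
proof
  assume h: "\<forall>B\<in>\<tau>. constant_on_set \<kappa> B"
  have "\<exists>C\<in>kernel_partition A \<kappa>. B \<subseteq> C" if B: "B \<in> \<tau>" for B
  proof -
    have "B \<noteq> {}" using B assms partition_onD3 by blast
    then obtain i where i: "i \<in> B" by blast
    have "B \<subseteq> A" using B assms by (auto simp: partition_on_def)
    then have "B \<subseteq> {j \<in> A. \<kappa> j = \<kappa> i}" using h B i unfolding constant_on_set_def by blast
    then show ?thesis using i \<open>B \<subseteq> A\<close> by (auto simp: kernel_partition_def)
  qed
  then show "refines A \<tau> (kernel_partition A \<kappa>)"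
    using assms partition_on_kernel by (auto simp: refines_def)
next
  assume h: "refines A \<tau> (kernel_partition A \<kappa>)"
  show "\<forall>B\<in>\<tau>. constant_on_set \<kappa> B"
  proof
    fix B assume "B \<in> \<tau>"
    then obtain C where C: "C \<in> kernel_partition A \<kappa>" "B \<subseteq> C"
      using h unfolding refines_def by blast
    then obtain k where "C = {j \<in> A. \<kappa> j = \<kappa> k}"
      unfolding kernel_partition_def by blast
    then show "constant_on_set \<kappa> B"
      using C(2) unfolding constant_on_set_def by fastforce
  qed
qed

text \<open>Inversion along refinement: constancy on the blocks of \<open>\<tau>\<close> means that
  the kernel is \<open>\<tau>\<close> or coarser, and the strictly coarser kernels are subtracted by
  induction on the number of coarser partitions.\<close>

lemma espan_kernel_eq:
  assumes "finite A" "partition_on A \<tau>"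
  shows "espan A (\<lambda>\<kappa>. of_bool (kernel_partition A \<kappa> = \<tau>))"
  using assms(2)
proof (induction "card {\<sigma>. refines A \<tau> \<sigma>}" arbitrary: \<tau> rule: less_induct)
  case less
  have fin: "finite {\<sigma>. refines A \<tau> \<sigma>}" for \<tau>
    by (rule finite_subset[OF _ finitely_many_partition_on[OF assms(1)]]) (auto simp: refines_def)
  let ?S = "{\<sigma>. refines A \<tau> \<sigma>} - {\<tau>}"
  have eq: "of_bool (kernel_partition A \<kappa> = \<tau>) = (of_bool (\<forall>B\<in>\<tau>. constant_on_set \<kappa> B) :: real)
      + (-1) * (\<Sum>\<sigma>\<in>?S. of_bool (kernel_partition A \<kappa> = \<sigma>))" for \<kappa>
  proof -
    have "(of_bool (\<forall>B\<in>\<tau>. constant_on_set \<kappa> B) :: real)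
        = (\<Sum>\<sigma> | refines A \<tau> \<sigma>. of_bool (kernel_partition A \<kappa> = \<sigma>))"
      using fin by (simp add: constant_on_blocks_iff[OF less.prems] of_bool_def)
    also have "\<dots> = of_bool (kernel_partition A \<kappa> = \<tau>) + (\<Sum>\<sigma>\<in>?S. of_bool (kernel_partition A \<kappa> = \<sigma>))"
      by (rule sum.remove) (use fin less.prems refines_refl in auto)
    finally show ?thesis by simp
  qed
  have "espan A (\<lambda>\<kappa>. of_bool (\<forall>B\<in>\<tau>. constant_on_set \<kappa> B))"
    using espan_constant_on_blocks[of \<tau>] less.prems assms(1)
    by (metis finite_elements finite_UnionD finite_subset Sup_upper partition_onD1 partition_onD2 partition_onD3)
  moreover have "espan A (\<lambda>\<kappa>. of_bool (kernel_partition A \<kappa> = \<sigma>))" if "\<sigma> \<in> ?S" for \<sigma>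
  proof (rule less.hyps)
    show "partition_on A \<sigma>" using that by (auto simp: refines_def)
    have "\<tau> \<notin> {\<rho>. refines A \<sigma> \<rho>}" using that refines_asym by blast
    moreover have "\<tau> \<in> {\<rho>. refines A \<tau> \<rho>}" using less.prems refines_refl by auto
    ultimately have "{\<rho>. refines A \<sigma> \<rho>} \<subset> {\<rho>. refines A \<tau> \<rho>}"
      using that refines_trans by blast
    then show "card {\<rho>. refines A \<sigma> \<rho>} < card {\<rho>. refines A \<tau> \<rho>}"
      by (intro psubset_card_mono fin)
  qed
  ultimately show ?case
    unfolding eq by (intro espan_add espan_scale espan_sum)
qed

text \<open>Supplies the expansion of \<open>YG\<close>, since properness of a colouring depends
  only on its colour classes.\<close>

lemma espan_of_kernel_invariant:
  assumes "finite A" "\<And>\<kappa> \<kappa>'. kernel_partition A \<kappa> = kernel_partition A \<kappa>' \<Longrightarrow> f \<kappa> = f \<kappa>'"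
  shows "espan A f"
proof -
  define g where "g \<sigma> = f (SOME \<kappa>. kernel_partition A \<kappa> = \<sigma>)" for \<sigma>
  have g: "g (kernel_partition A \<kappa>) = f \<kappa>" for \<kappa>
    unfolding g_def by (rule assms(2)) (rule someI[of "\<lambda>\<kappa>'. kernel_partition A \<kappa>' = kernel_partition A \<kappa>"], simp)
  have eq: "f = (\<lambda>\<kappa>. \<Sum>\<sigma> | partition_on A \<sigma>. g \<sigma> * of_bool (kernel_partition A \<kappa> = \<sigma>))"
  proof
    fix \<kappa>
    have "(\<Sum>\<sigma> | partition_on A \<sigma>. g \<sigma> * of_bool (kernel_partition A \<kappa> = \<sigma>))
       = (\<Sum>\<sigma> | partition_on A \<sigma>. if kernel_partition A \<kappa> = \<sigma> then g (kernel_partition A \<kappa>) else 0)"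
      by (intro sum.cong) auto
    then show "f \<kappa> = (\<Sum>\<sigma> | partition_on A \<sigma>. g \<sigma> * of_bool (kernel_partition A \<kappa> = \<sigma>))"
      using assms(1) by (simp add: finitely_many_partition_on partition_on_kernel g)
  qed
  show ?thesis
    unfolding eq using assms(1) by (intro espan_sum espan_scale espan_kernel_eq) auto
qed

text \<open>Injectivity on \<open>B\<close> means that \<open>B\<close> meets each colour class at
  most once. In this form the roles of the two partitions are symmetric, which the independence
  proof exploits.\<close>

lemma e_basis_kernel:
  assumes "partition_on A \<pi>"
  shows "e_basis \<pi> \<kappa> = of_bool (\<forall>B\<in>\<pi>. \<forall>C\<in>kernel_partition A \<kappa>. \<forall>i\<in>B \<inter> C. \<forall>j\<in>B \<inter> C. i = j)"
proof -
  have "inj_on \<kappa> B \<longleftrightarrow> (\<forall>C\<in>kernel_partition A \<kappa>. \<forall>i\<in>B \<inter> C. \<forall>j\<in>B \<inter> C. i = j)" (is "_ \<longleftrightarrow> ?R")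
    if "B \<in> \<pi>" for B
  proof -
    have "B \<subseteq> A" using that assms by (auto simp: partition_on_def)
    then have "inj_on \<kappa> B \<longleftrightarrow> (\<forall>i\<in>B. \<forall>j\<in>B. (\<exists>C\<in>kernel_partition A \<kappa>. i \<in> C \<and> j \<in> C) \<longrightarrow> i = j)"
      unfolding inj_on_def by (simp add: kernel_partition_eq_iff[where A = A and \<kappa> = \<kappa>] subset_iff)
    also have "\<dots> \<longleftrightarrow> ?R" by blast
    finally show ?thesis .
  qed
  then show ?thesis by (auto simp: e_basis_def)
qed

text \<open>The matrix of the values \<open>e_basis \<pi> \<kappa>\<^sub>\<sigma>\<close>, with \<open>\<kappa>\<^sub>\<sigma>\<close> of kernel \<open>\<sigma>\<close>, is symmetric,
  so that a one-sided inverse is provided by the spanning property.\<close>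

lemma e_basis_independent:
  assumes A: "finite A"
    and rep: "\<And>\<sigma>. partition_on A \<sigma> \<Longrightarrow> kernel_partition A (rep \<sigma>) = \<sigma>"
    and zero: "\<And>\<sigma>. partition_on A \<sigma> \<Longrightarrow> (\<Sum>\<pi> | partition_on A \<pi>. c \<pi> * e_basis \<pi> (rep \<sigma>)) = 0"
    and \<tau>: "partition_on A \<tau>"
  shows "c \<tau> = 0"
proof -
  let ?P = "{\<pi>. partition_on A \<pi>}"
  have sym: "e_basis \<pi> (rep \<sigma>) = e_basis \<sigma> (rep \<pi>)" if "\<pi> \<in> ?P" "\<sigma> \<in> ?P" for \<pi> \<sigma>
    using that by (auto simp: e_basis_kernel[of A] rep)
  obtain a where a: "\<And>\<kappa>. of_bool (kernel_partition A \<kappa> = \<tau>) = (\<Sum>\<pi>\<in>?P. a \<pi> * e_basis \<pi> \<kappa>)"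
    using espan_kernel_eq[OF A \<tau>] unfolding espan_def by blast
  have "0 = (\<Sum>\<sigma>\<in>?P. a \<sigma> * (\<Sum>\<pi>\<in>?P. c \<pi> * e_basis \<pi> (rep \<sigma>)))"
    using zero by simp
  also have "\<dots> = (\<Sum>\<sigma>\<in>?P. \<Sum>\<pi>\<in>?P. c \<pi> * (a \<sigma> * e_basis \<sigma> (rep \<pi>)))"
    unfolding sum_distrib_left by (intro sum.cong refl) (simp add: sym mult_ac)
  also have "\<dots> = (\<Sum>\<pi>\<in>?P. c \<pi> * of_bool (kernel_partition A (rep \<pi>) = \<tau>))"
    unfolding a sum_distrib_left by (rule sum.swap)
  also have "\<dots> = (\<Sum>\<pi>\<in>?P. if \<pi> = \<tau> then c \<tau> else 0)"
    by (intro sum.cong) (auto simp: rep)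
  also have "\<dots> = c \<tau>"
    using \<tau> A by (simp add: finitely_many_partition_on)
  finally show ?thesis by simp
qed

section \<open>Commutative images\<close>

lemma sum_PiE_insert:
  assumes "v \<notin> A"
  shows "(\<Sum>\<kappa>\<in>Pi\<^sub>E (insert v A) T. g \<kappa>) = (\<Sum>c\<in>T v. \<Sum>\<kappa>\<in>Pi\<^sub>E A T. g (\<kappa>(v := c)))"
  unfolding PiE_insert_eq
  by (subst sum.reindex[OF inj_combinator[OF assms]]) (simp add: sum.cartesian_product case_prod_unfold)

lemma sum_PiE_Un:
  fixes g h :: "('a \<Rightarrow> 'b) \<Rightarrow> 'r::{comm_ring_1,ring_char_0}"
  assumes "finite A" "A \<inter> B = {}"
    and "\<And>\<kappa> \<kappa>'. (\<And>i. i \<in> A \<Longrightarrow> \<kappa> i = \<kappa>' i) \<Longrightarrow> g \<kappa> = g \<kappa>'"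
    and "\<And>\<kappa> \<kappa>'. (\<And>i. i \<in> B \<Longrightarrow> \<kappa> i = \<kappa>' i) \<Longrightarrow> h \<kappa> = h \<kappa>'"
  shows "(\<Sum>\<kappa>\<in>Pi\<^sub>E (A \<union> B) (\<lambda>_. C). g \<kappa> * h \<kappa>)
    = (\<Sum>\<kappa>\<in>Pi\<^sub>E A (\<lambda>_. C). g \<kappa>) * (\<Sum>\<kappa>\<in>Pi\<^sub>E B (\<lambda>_. C). h \<kappa>)"
  using assms(1-3)
proof (induction A arbitrary: g rule: finite_induct)
  case empty
  obtain k where "g = (\<lambda>_. k)"
  proof
    show "g = (\<lambda>_. g (\<lambda>_. undefined))" by (rule ext, rule empty) simp
  qed
  then show ?case by (simp add: sum_distrib_left)
next
  case (insert v A)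
  have vn: "v \<notin> A \<union> B" using insert(2) insert.prems(1) by auto
  have hv: "h (\<kappa>(v := c)) = h \<kappa>" for \<kappa> c
    by (rule assms(4)) (use insert.prems in auto)
  have "(\<Sum>\<kappa>\<in>Pi\<^sub>E (insert v A \<union> B) (\<lambda>_. C). g \<kappa> * h \<kappa>)
     = (\<Sum>c\<in>C. \<Sum>\<kappa>\<in>Pi\<^sub>E (A \<union> B) (\<lambda>_. C). g (\<kappa>(v := c)) * h \<kappa>)"
    using sum_PiE_insert[OF vn, of "\<lambda>\<kappa>. g \<kappa> * h \<kappa>" "\<lambda>_. C"] by (simp add: hv)
  also have "\<dots> = (\<Sum>c\<in>C. (\<Sum>\<kappa>\<in>Pi\<^sub>E A (\<lambda>_. C). g (\<kappa>(v := c))) * (\<Sum>\<kappa>\<in>Pi\<^sub>E B (\<lambda>_. C). h \<kappa>))"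
  proof (rule sum.cong[OF refl], rule insert.IH)
    fix c and \<kappa> \<kappa>' :: "'a \<Rightarrow> 'b" assume "\<And>i. i \<in> A \<Longrightarrow> \<kappa> i = \<kappa>' i"
    then show "g (\<kappa>(v := c)) = g (\<kappa>'(v := c))" by (intro insert.prems) auto
  qed (use insert.prems in auto)
  also have "\<dots> = (\<Sum>\<kappa>\<in>Pi\<^sub>E (insert v A) (\<lambda>_. C). g \<kappa>) * (\<Sum>\<kappa>\<in>Pi\<^sub>E B (\<lambda>_. C). h \<kappa>)"
    by (simp add: sum_PiE_insert[OF insert(2)] sum_distrib_right)
  finally show ?case .
qed

text \<open>Fixing the colour \<open>c\<close> of \<open>v\<close> leaves injective words over
  \<open>C - {c}\<close>, so the induction runs over all alphabets; \<open>sum_esym_remove\<close>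
  then turns the factorial of \<open>card A\<close> into the next one.\<close>

lemma sum_injective_words:
  fixes x :: "'b \<Rightarrow> 'r::{comm_ring_1,ring_char_0}"
  assumes "finite A" "finite C"
  shows "(\<Sum>\<kappa>\<in>Pi\<^sub>E A (\<lambda>_. C). of_bool (inj_on \<kappa> A) * (\<Prod>i\<in>A. x (\<kappa> i))) = fact (card A) * esym x C (card A)"
  using assms
proof (induction A arbitrary: C rule: finite_induct)
  case empty
  then show ?case by (simp add: esym_0)
next
  case (insert v A)
  have "(\<Sum>\<kappa>\<in>Pi\<^sub>E (insert v A) (\<lambda>_. C). of_bool (inj_on \<kappa> (insert v A)) * (\<Prod>i\<in>insert v A. x (\<kappa> i)))
    = (\<Sum>c\<in>C. \<Sum>\<kappa>\<in>Pi\<^sub>E A (\<lambda>_. C). of_bool (inj_on \<kappa> A \<and> c \<notin> \<kappa> ` A) * (x c * (\<Prod>i\<in>A. x (\<kappa> i))))"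
    unfolding sum_PiE_insert[OF insert(2)]
  proof (intro sum.cong refl)
    fix c and \<kappa> :: "'a \<Rightarrow> 'b"
    have "inj_on (\<kappa>(v := c)) (insert v A) \<longleftrightarrow> inj_on \<kappa> A \<and> c \<notin> \<kappa> ` A"
    proof -
      have "inj_on (\<kappa>(v := c)) A \<longleftrightarrow> inj_on \<kappa> A" "(\<kappa>(v := c)) ` (A - {v}) = \<kappa> ` A"
        using insert(2) by (auto intro!: inj_on_cong image_cong)
      then show ?thesis by simp
    qed
    moreover have "(\<Prod>i\<in>A. x ((\<kappa>(v := c)) i)) = (\<Prod>i\<in>A. x (\<kappa> i))"
      using insert(2) by (intro prod.cong) auto
    ultimately show "of_bool (inj_on (\<kappa>(v := c)) (insert v A)) * (\<Prod>i\<in>insert v A. x ((\<kappa>(v := c)) i))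
      = of_bool (inj_on \<kappa> A \<and> c \<notin> \<kappa> ` A) * (x c * (\<Prod>i\<in>A. x (\<kappa> i)))"
      using insert by simp
  qed
  also have "\<dots> = (\<Sum>c\<in>C. x c * (\<Sum>\<kappa>\<in>Pi\<^sub>E A (\<lambda>_. C - {c}). of_bool (inj_on \<kappa> A) * (\<Prod>i\<in>A. x (\<kappa> i))))"
    unfolding sum_distrib_left
  proof (rule sum.cong[OF refl], rule sum.mono_neutral_cong_right)
    fix c
    show "finite (Pi\<^sub>E A (\<lambda>_. C))" using insert by (intro finite_PiE) auto
    show "Pi\<^sub>E A (\<lambda>_. C - {c}) \<subseteq> Pi\<^sub>E A (\<lambda>_. C)" by (intro PiE_mono) auto
    show "\<forall>\<kappa>\<in>Pi\<^sub>E A (\<lambda>_. C) - Pi\<^sub>E A (\<lambda>_. C - {c}).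
        of_bool (inj_on \<kappa> A \<and> c \<notin> \<kappa> ` A) * (x c * (\<Prod>i\<in>A. x (\<kappa> i))) = 0"
      by (auto simp: PiE_iff)
    fix \<kappa> assume "\<kappa> \<in> Pi\<^sub>E A (\<lambda>_. C - {c})"
    then have "c \<notin> \<kappa> ` A" by auto
    then show "of_bool (inj_on \<kappa> A \<and> c \<notin> \<kappa> ` A) * (x c * (\<Prod>i\<in>A. x (\<kappa> i)))
      = x c * (of_bool (inj_on \<kappa> A) * (\<Prod>i\<in>A. x (\<kappa> i)))" by simp
  qed
  also have "\<dots> = (\<Sum>c\<in>C. x c * (fact (card A) * esym x (C - {c}) (card A)))"
    using insert by (intro sum.cong refl) simp
  also have "\<dots> = fact (card A) * (\<Sum>c\<in>C. x c * esym x (C - {c}) (card A))"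
    by (simp add: sum_distrib_left mult_ac)
  also have "\<dots> = fact (card (insert v A)) * esym x C (card (insert v A))"
    using insert sum_esym_remove[OF insert(4), of x "card A"] by (simp add: algebra_simps)
  finally show ?case .
qed

lemma sum_words_injective_on_blocks:
  fixes x :: "'b \<Rightarrow> 'r::{comm_ring_1,ring_char_0}"
  assumes "finite C" "finite \<tau>" "disjoint \<tau>" "\<And>B. B \<in> \<tau> \<Longrightarrow> finite B"
  shows "(\<Sum>\<kappa>\<in>Pi\<^sub>E (\<Union>\<tau>) (\<lambda>_. C). of_bool (\<forall>B\<in>\<tau>. inj_on \<kappa> B) * (\<Prod>i\<in>\<Union>\<tau>. x (\<kappa> i)))
    = (\<Prod>B\<in>\<tau>. fact (card B) * esym x C (card B))"
  using assms(2-4)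
proof (induction \<tau> rule: finite_induct)
  case empty
  then show ?case by simp
next
  case (insert B \<tau>)
  have d: "B \<inter> \<Union>\<tau> = {}"
    using insert by (auto simp: disjoint_def)
  have "(\<Sum>\<kappa>\<in>Pi\<^sub>E (\<Union>(insert B \<tau>)) (\<lambda>_. C). of_bool (\<forall>B\<in>insert B \<tau>. inj_on \<kappa> B) * (\<Prod>i\<in>\<Union>(insert B \<tau>). x (\<kappa> i)))
    = (\<Sum>\<kappa>\<in>Pi\<^sub>E (B \<union> \<Union>\<tau>) (\<lambda>_. C). (of_bool (inj_on \<kappa> B) * (\<Prod>i\<in>B. x (\<kappa> i)))
        * (of_bool (\<forall>B\<in>\<tau>. inj_on \<kappa> B) * (\<Prod>i\<in>\<Union>\<tau>. x (\<kappa> i))))"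
    using insert d by (simp add: prod.union_disjoint of_bool_conj mult_ac)
  also have "\<dots> = (\<Sum>\<kappa>\<in>Pi\<^sub>E B (\<lambda>_. C). of_bool (inj_on \<kappa> B) * (\<Prod>i\<in>B. x (\<kappa> i)))
      * (\<Sum>\<kappa>\<in>Pi\<^sub>E (\<Union>\<tau>) (\<lambda>_. C). of_bool (\<forall>B\<in>\<tau>. inj_on \<kappa> B) * (\<Prod>i\<in>\<Union>\<tau>. x (\<kappa> i)))"
  proof (rule sum_PiE_Un)
    show "of_bool (inj_on \<kappa> B) * (\<Prod>i\<in>B. x (\<kappa> i)) = of_bool (inj_on \<kappa>' B) * (\<Prod>i\<in>B. x (\<kappa>' i))"
      if "\<And>i. i \<in> B \<Longrightarrow> \<kappa> i = \<kappa>' i" for \<kappa> \<kappa>'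
      using that inj_on_cong[of B \<kappa> \<kappa>'] by simp
    show "of_bool (\<forall>B\<in>\<tau>. inj_on \<kappa> B) * (\<Prod>i\<in>\<Union>\<tau>. x (\<kappa> i))
        = of_bool (\<forall>B\<in>\<tau>. inj_on \<kappa>' B) * (\<Prod>i\<in>\<Union>\<tau>. x (\<kappa>' i))"
      if "\<And>i. i \<in> \<Union>\<tau> \<Longrightarrow> \<kappa> i = \<kappa>' i" for \<kappa> \<kappa>'
    proof -
      have "inj_on \<kappa> B \<longleftrightarrow> inj_on \<kappa>' B" if "B \<in> \<tau>" for B
        using \<open>\<And>i. i \<in> \<Union>\<tau> \<Longrightarrow> \<kappa> i = \<kappa>' i\<close> that by (intro inj_on_cong) auto
      then show ?thesis using that by simp
    qed
  qed (use insert d in auto)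
  also have "\<dots> = (\<Prod>B\<in>insert B \<tau>. fact (card B) * esym x C (card B))"
    using insert assms(1) sum_injective_words[of B C x] by (simp add: disjoint_def)
  finally show ?case .
qed

text \<open>The root \<open>v\<close> contributes no letter; its colour \<open>a\<close> is merely
  withdrawn from the alphabet of the other vertices.\<close>

lemma sum_rooted_injective_words:
  fixes x :: "'b \<Rightarrow> 'r::{comm_ring_1,ring_char_0}"
  assumes "finite A" "finite C" "v \<notin> A" "a \<in> C"
  shows "(\<Sum>\<kappa>\<in>Pi\<^sub>E (insert v A) (\<lambda>_. C). of_bool (\<kappa> v = a) * of_bool (inj_on \<kappa> (insert v A)) * (\<Prod>i\<in>A. x (\<kappa> i)))
    = fact (card A) * esym x (C - {a}) (card A)"
proof -
  have "(\<Sum>\<kappa>\<in>Pi\<^sub>E (insert v A) (\<lambda>_. C). of_bool (\<kappa> v = a) * of_bool (inj_on \<kappa> (insert v A)) * (\<Prod>i\<in>A. x (\<kappa> i)))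
    = (\<Sum>c\<in>C. if c = a then (\<Sum>\<kappa>\<in>Pi\<^sub>E A (\<lambda>_. C). of_bool (inj_on \<kappa> A \<and> a \<notin> \<kappa> ` A) * (\<Prod>i\<in>A. x (\<kappa> i))) else 0)"
    unfolding sum_PiE_insert[OF assms(3)]
  proof (intro sum.cong refl)
    fix c
    have "inj_on (\<kappa>(v := c)) (insert v A) \<longleftrightarrow> inj_on \<kappa> A \<and> c \<notin> \<kappa> ` A" for \<kappa> :: "'a \<Rightarrow> 'b"
    proof -
      have "inj_on (\<kappa>(v := c)) A \<longleftrightarrow> inj_on \<kappa> A" "(\<kappa>(v := c)) ` (A - {v}) = \<kappa> ` A"
        using assms(3) by (auto intro!: inj_on_cong image_cong)
      then show ?thesis by simp
    qed
    moreover have "(\<Prod>i\<in>A. x ((\<kappa>(v := c)) i)) = (\<Prod>i\<in>A. x (\<kappa> i))" for \<kappa>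
      using assms(3) by (intro prod.cong) auto
    ultimately show "(\<Sum>\<kappa>\<in>Pi\<^sub>E A (\<lambda>_. C). of_bool ((\<kappa>(v := c)) v = a) * of_bool (inj_on (\<kappa>(v := c)) (insert v A))
        * (\<Prod>i\<in>A. x ((\<kappa>(v := c)) i)))
      = (if c = a then (\<Sum>\<kappa>\<in>Pi\<^sub>E A (\<lambda>_. C). of_bool (inj_on \<kappa> A \<and> a \<notin> \<kappa> ` A) * (\<Prod>i\<in>A. x (\<kappa> i))) else 0)"
      by simp
  qed
  also have "\<dots> = (\<Sum>\<kappa>\<in>Pi\<^sub>E A (\<lambda>_. C). of_bool (inj_on \<kappa> A \<and> a \<notin> \<kappa> ` A) * (\<Prod>i\<in>A. x (\<kappa> i)))"
    using assms by simp
  also have "\<dots> = (\<Sum>\<kappa>\<in>Pi\<^sub>E A (\<lambda>_. C - {a}). of_bool (inj_on \<kappa> A) * (\<Prod>i\<in>A. x (\<kappa> i)))"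
  proof (rule sum.mono_neutral_cong_right)
    show "finite (Pi\<^sub>E A (\<lambda>_. C))" using assms by (intro finite_PiE) auto
    show "Pi\<^sub>E A (\<lambda>_. C - {a}) \<subseteq> Pi\<^sub>E A (\<lambda>_. C)" by (intro PiE_mono) auto
    show "\<forall>\<kappa>\<in>Pi\<^sub>E A (\<lambda>_. C) - Pi\<^sub>E A (\<lambda>_. C - {a}).
        of_bool (inj_on \<kappa> A \<and> a \<notin> \<kappa> ` A) * (\<Prod>i\<in>A. x (\<kappa> i)) = 0"
      by (auto simp: PiE_iff)
    fix \<kappa> assume "\<kappa> \<in> Pi\<^sub>E A (\<lambda>_. C - {a})"
    then have "a \<notin> \<kappa> ` A" by auto
    then show "of_bool (inj_on \<kappa> A \<and> a \<notin> \<kappa> ` A) * (\<Prod>i\<in>A. x (\<kappa> i))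
      = of_bool (inj_on \<kappa> A) * (\<Prod>i\<in>A. x (\<kappa> i))" by simp
  qed
  also have "\<dots> = fact (card A) * esym x (C - {a}) (card A)"
    using assms by (intro sum_injective_words) auto
  finally show ?thesis .
qed

lemma block_of:
  assumes "partition_on A \<pi>" "i \<in> A"
  shows "block_of \<pi> i \<in> \<pi>" "i \<in> block_of \<pi> i"
proof -
  have "\<exists>!B. B \<in> \<pi> \<and> i \<in> B"
    using assms by (auto simp: partition_on_def disjoint_def)
  from theI'[OF this] show "block_of \<pi> i \<in> \<pi>" "i \<in> block_of \<pi> i"
    by (auto simp: block_of_def)
qed

lemma block_of_eq: "partition_on A \<pi> \<Longrightarrow> B \<in> \<pi> \<Longrightarrow> i \<in> B \<Longrightarrow> block_of \<pi> i = B"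
  unfolding block_of_def by (rule the_equality) (auto simp: partition_on_def disjoint_def)

definition block_type :: "nat \<Rightarrow> nat set set \<Rightarrow> nat multiset \<times> nat" where
  "block_type n \<pi> = (image_mset card (mset_set \<pi>), card (block_of \<pi> n))"

lemma part_sim_iff: "part_sim n \<pi> \<sigma> \<longleftrightarrow> block_type n \<pi> = block_type n \<sigma>"
  by (simp add: part_sim_def block_type_def)

lemma finite_set_partitions: "finite (set_partitions n)"
  by (simp add: set_partitions_def finitely_many_partition_on)

section \<open>Commutative images of the \<open>e_basis\<close>\<close>

context alphabet
begin

definition rooted_sum :: "nat \<Rightarrow> ((nat \<Rightarrow> 'i) \<Rightarrow> real) \<Rightarrow> 'i \<Rightarrow> 'r" where
  "rooted_sum n f a = (\<Sum>\<kappa>\<in>Pi\<^sub>E {1..n} (\<lambda>_. C). of_bool (\<kappa> n = a) * cst (f \<kappa>) * (\<Prod>i\<in>{1..<n}. x (\<kappa> i)))"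

lemma cst_sum: "cst (\<Sum>i\<in>I. g i) = (\<Sum>i\<in>I. cst (g i))"
  by (induction I rule: infinite_finite_induct) (auto simp: cst_0 cst_add)

lemma cst_of_bool: "cst (of_bool b) = of_bool b"
  by (simp add: cst_0 cst_1)

lemma rooted_sum_cong:
  "(\<And>\<kappa>. \<kappa> \<in> Pi\<^sub>E {1..n} (\<lambda>_. C) \<Longrightarrow> f \<kappa> = g \<kappa>) \<Longrightarrow> rooted_sum n f a = rooted_sum n g a"
  unfolding rooted_sum_def by (intro sum.cong) auto

lemma rooted_sum_sum:
  "rooted_sum n (\<lambda>\<kappa>. \<Sum>\<pi>\<in>P. c \<pi> * f \<pi> \<kappa>) a = (\<Sum>\<pi>\<in>P. cst (c \<pi>) * rooted_sum n (f \<pi>) a)"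
  unfolding rooted_sum_def cst_sum cst_mult sum_distrib_left sum_distrib_right
  by (subst sum.swap) (simp add: mult_ac)

definition blocks_weight :: "nat set set \<Rightarrow> 'r" where
  "blocks_weight \<tau> = (\<Prod>B\<in>\<tau>. fact (card B) * e (card B))"

lemma rooted_sum_inj_on_blocks:
  assumes "partition_on {1..n} \<pi>" "1 \<le> n" "a \<in> C"
  shows "rooted_sum n (\<lambda>\<kappa>. of_bool (\<forall>B\<in>\<pi>. inj_on \<kappa> B)) a
    = blocks_weight (\<pi> - {block_of \<pi> n}) * (fact (card (block_of \<pi> n) - 1) * E (card (block_of \<pi> n)) (x a))"
proof -
  let ?R = "block_of \<pi> n"
  let ?A = "?R - {n}" and ?\<tau> = "\<pi> - {?R}"
  have R: "?R \<in> \<pi>" "n \<in> ?R" using block_of[OF assms(1)] assms(2) by auto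
  have U: "\<Union>\<pi> = {1..n}" using assms(1) by (simp add: partition_on_def)
  then have sub: "B \<subseteq> {1..n}" if "B \<in> \<pi>" for B using that by blast
  have RU: "?R \<union> \<Union>?\<tau> = {1..n}" "finite ?R" "finite \<pi>" "\<And>B. B \<in> \<pi> \<Longrightarrow> finite B"
    using U R finite_elements[OF _ assms(1)] finite_subset[OF sub] by auto
  have d: "?R \<inter> \<Union>?\<tau> = {}" "disjoint ?\<tau>"
  proof -
    have "?R \<inter> B = {}" if "B \<in> ?\<tau>" for B
      using disjointD[OF partition_onD2[OF assms(1)], of ?R B] that R by auto
    then show "?R \<inter> \<Union>?\<tau> = {}" by blast
    show "disjoint ?\<tau>"
      using partition_onD2[OF assms(1)] by (auto simp: disjoint_def)
  qed
  have split: "{1..<n} = ?A \<union> \<Union>?\<tau>"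
  proof -
    have "{1..<n} = {1..n} - {n}" by auto
    then show ?thesis using RU(1) d(1) R(2) by blast
  qed
  have pr: "(\<Prod>i\<in>{1..<n}. x (\<kappa> i)) = (\<Prod>i\<in>?A. x (\<kappa> i)) * (\<Prod>i\<in>\<Union>?\<tau>. x (\<kappa> i))" for \<kappa>
    unfolding split using d RU by (intro prod.union_disjoint) auto
  have ob: "of_bool (\<forall>B\<in>\<pi>. inj_on \<kappa> B) = (of_bool (inj_on \<kappa> ?R) * of_bool (\<forall>B\<in>?\<tau>. inj_on \<kappa> B) :: 'r)"
    for \<kappa> :: "nat \<Rightarrow> 'i"
    using R by auto
  have "rooted_sum n (\<lambda>\<kappa>. of_bool (\<forall>B\<in>\<pi>. inj_on \<kappa> B)) a
    = (\<Sum>\<kappa>\<in>Pi\<^sub>E (?R \<union> \<Union>?\<tau>) (\<lambda>_. C).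
        (of_bool (\<kappa> n = a) * of_bool (inj_on \<kappa> ?R) * (\<Prod>i\<in>?A. x (\<kappa> i)))
        * (of_bool (\<forall>B\<in>?\<tau>. inj_on \<kappa> B) * (\<Prod>i\<in>\<Union>?\<tau>. x (\<kappa> i))))"
    unfolding rooted_sum_def RU cst_of_bool ob pr by (simp only: mult_ac)
  also have "\<dots> = (\<Sum>\<kappa>\<in>Pi\<^sub>E ?R (\<lambda>_. C). of_bool (\<kappa> n = a) * of_bool (inj_on \<kappa> ?R) * (\<Prod>i\<in>?A. x (\<kappa> i)))
      * (\<Sum>\<kappa>\<in>Pi\<^sub>E (\<Union>?\<tau>) (\<lambda>_. C). of_bool (\<forall>B\<in>?\<tau>. inj_on \<kappa> B) * (\<Prod>i\<in>\<Union>?\<tau>. x (\<kappa> i)))"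
  proof (rule sum_PiE_Un)
    show "of_bool (\<kappa> n = a) * of_bool (inj_on \<kappa> ?R) * (\<Prod>i\<in>?A. x (\<kappa> i))
       = of_bool (\<kappa>' n = a) * of_bool (inj_on \<kappa>' ?R) * (\<Prod>i\<in>?A. x (\<kappa>' i))"
      if "\<And>i. i \<in> ?R \<Longrightarrow> \<kappa> i = \<kappa>' i" for \<kappa> \<kappa>'
      using that R inj_on_cong[of ?R \<kappa> \<kappa>'] by simp
    show "of_bool (\<forall>B\<in>?\<tau>. inj_on \<kappa> B) * (\<Prod>i\<in>\<Union>?\<tau>. x (\<kappa> i))
        = of_bool (\<forall>B\<in>?\<tau>. inj_on \<kappa>' B) * (\<Prod>i\<in>\<Union>?\<tau>. x (\<kappa>' i))"
      if eq: "\<And>i. i \<in> \<Union>?\<tau> \<Longrightarrow> \<kappa> i = \<kappa>' i" for \<kappa> \<kappa>'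
    proof -
      have "inj_on \<kappa> B \<longleftrightarrow> inj_on \<kappa>' B" if "B \<in> ?\<tau>" for B
        using eq that by (intro inj_on_cong) auto
      moreover have "(\<Prod>i\<in>\<Union>?\<tau>. x (\<kappa> i)) = (\<Prod>i\<in>\<Union>?\<tau>. x (\<kappa>' i))"
        using eq by (intro prod.cong) auto
      ultimately show ?thesis by simp
    qed
  qed (use RU d in auto)
  also have "(\<Sum>\<kappa>\<in>Pi\<^sub>E (\<Union>?\<tau>) (\<lambda>_. C). of_bool (\<forall>B\<in>?\<tau>. inj_on \<kappa> B) * (\<Prod>i\<in>\<Union>?\<tau>. x (\<kappa> i)))
      = blocks_weight ?\<tau>"
    unfolding blocks_weight_def e_def using RU d fin by (intro sum_words_injective_on_blocks) auto
  also have "(\<Sum>\<kappa>\<in>Pi\<^sub>E ?R (\<lambda>_. C). of_bool (\<kappa> n = a) * of_bool (inj_on \<kappa> ?R) * (\<Prod>i\<in>?A. x (\<kappa> i)))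
      = fact (card ?A) * esym x (C - {a}) (card ?A)"
    using sum_rooted_injective_words[of ?A C n a x] RU fin assms(3) R by (simp add: insert_absorb)
  also have "\<dots> = fact (card ?R - 1) * E (card ?R) (x a)"
  proof -
    have "card ?R = Suc (card ?A)" by (rule card.remove[OF RU(2) R(2)])
    then show ?thesis by (simp only: E_eq_esym[OF assms(3)] diff_Suc_1)
  qed
  finally show ?thesis by (simp add: mult_ac)
qed

text \<open>Exhibits the weight as a function of block sizes alone, hence as constant on the classes
  of \<open>part_sim\<close>.\<close>

lemma blocks_weight_remove:
  assumes "finite \<pi>" "R \<in> \<pi>"
  shows "blocks_weight (\<pi> - {R})
    = prod_mset (image_mset (\<lambda>k. fact k * e k) (image_mset card (mset_set \<pi>) - {#card R#}))"
proof -
  have "mset_set \<pi> = add_mset R (mset_set (\<pi> - {R}))"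
    using assms by (simp add: mset_set.remove)
  then have "image_mset card (mset_set \<pi>) - {#card R#} = image_mset card (mset_set (\<pi> - {R}))"
    by simp
  then show ?thesis
    unfolding blocks_weight_def prod_unfold_prod_mset by (simp add: image_mset.compositionality o_def)
qed

end

section \<open>Attaching triangular ladders\<close>

locale colour_alphabet = alphabet C x cst
  for C :: "nat set" and x :: "nat \<Rightarrow> 'r::{comm_ring_1,ring_char_0}" and cst :: "real \<Rightarrow> 'r" +
  assumes C_pos: "C \<subseteq> {1..}"
begin

definition pair_sum :: "nat \<Rightarrow> ((nat \<Rightarrow> nat) \<Rightarrow> real) \<Rightarrow> nat \<Rightarrow> nat \<Rightarrow> 'r" where
  "pair_sum p f y z = (\<Sum>\<kappa>\<in>Pi\<^sub>E {1..p} (\<lambda>_. C).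
     of_bool (\<kappa> (p - 1) = y) * of_bool (\<kappa> p = z) * cst (f \<kappa>) * (\<Prod>i\<in>{1..<p}. x (\<kappa> i)))"

lemma sum_of_bool_eq_in:
  assumes "finite A" "b \<in> A"
  shows "(\<Sum>y\<in>A. of_bool (b = y) * g) = (g :: 'r)"
proof -
  have "(\<Sum>y\<in>A. of_bool (b = y) * g) = (\<Sum>y\<in>A. if b = y then g else 0)"
    by (intro sum.cong) auto
  then show ?thesis using assms by simp
qed

lemma sum_of_bool_eq_notin:
  assumes "b \<notin> A"
  shows "(\<Sum>y\<in>A. of_bool (b = y) * g) = (0 :: 'r)"
  by (rule sum.neutral) (use assms in auto)

lemma rooted_sum_pair_sum:
  assumes "2 \<le> p"
  shows "rooted_sum p f z = (\<Sum>y\<in>C. pair_sum p f y z)"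
proof -
  have "(\<Sum>y\<in>C. pair_sum p f y z) = (\<Sum>\<kappa>\<in>Pi\<^sub>E {1..p} (\<lambda>_. C). \<Sum>y\<in>C. of_bool (\<kappa> (p - 1) = y)
      * (of_bool (\<kappa> p = z) * cst (f \<kappa>) * (\<Prod>i\<in>{1..<p}. x (\<kappa> i))))"
    unfolding pair_sum_def by (subst sum.swap) (simp only: mult.assoc)
  also have "\<dots> = rooted_sum p f z"
    unfolding rooted_sum_def
  proof (rule sum.cong[OF refl], rule sum_of_bool_eq_in[OF fin])
    fix \<kappa> assume k: "\<kappa> \<in> Pi\<^sub>E {1..p} (\<lambda>_. C)"
    have "p - 1 \<in> {1..p}" using assms by auto
    from PiE_mem[OF k this] show "\<kappa> (p - 1) \<in> C" .
  qed
  finally show ?thesis by simp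
qed

lemma pair_sum_Suc:
  assumes "1 \<le> p" "w \<in> C"
  shows "pair_sum (Suc p) g z w = x z * (\<Sum>\<kappa>\<in>Pi\<^sub>E {1..p} (\<lambda>_. C).
     of_bool (\<kappa> p = z) * cst (g (\<kappa>(Suc p := w))) * (\<Prod>i\<in>{1..<p}. x (\<kappa> i)))"
proof -
  have ins: "{1..Suc p} = insert (Suc p) {1..p}" by auto
  have pr: "(\<Prod>i\<in>{1..<Suc p}. x ((\<kappa>(Suc p := c)) i)) = x (\<kappa> p) * (\<Prod>i\<in>{1..<p}. x (\<kappa> i))" for \<kappa> c
  proof -
    have a: "{1..<Suc p} = insert p {1..<p}" using assms by auto
    have b: "(\<Prod>i\<in>{1..<p}. x ((\<kappa>(Suc p := c)) i)) = (\<Prod>i\<in>{1..<p}. x (\<kappa> i))"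
      by (intro prod.cong) auto
    show ?thesis unfolding a using b by simp
  qed
  have "pair_sum (Suc p) g z w = (\<Sum>c\<in>C. of_bool (w = c) * (\<Sum>\<kappa>\<in>Pi\<^sub>E {1..p} (\<lambda>_. C).
     of_bool (\<kappa> p = z) * cst (g (\<kappa>(Suc p := w))) * (x (\<kappa> p) * (\<Prod>i\<in>{1..<p}. x (\<kappa> i)))))"
    unfolding pair_sum_def ins using assms(1)
    by (subst sum_PiE_insert) (auto simp: pr sum_distrib_left intro!: sum.cong)
  also have "\<dots> = (\<Sum>\<kappa>\<in>Pi\<^sub>E {1..p} (\<lambda>_. C).
     of_bool (\<kappa> p = z) * cst (g (\<kappa>(Suc p := w))) * (x (\<kappa> p) * (\<Prod>i\<in>{1..<p}. x (\<kappa> i))))"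
    using assms(2) by (rule sum_of_bool_eq_in[OF fin])
  also have "\<dots> = x z * (\<Sum>\<kappa>\<in>Pi\<^sub>E {1..p} (\<lambda>_. C).
     of_bool (\<kappa> p = z) * cst (g (\<kappa>(Suc p := w))) * (\<Prod>i\<in>{1..<p}. x (\<kappa> i)))"
    unfolding sum_distrib_left by (intro sum.cong) (auto simp: mult_ac)
  finally show ?thesis .
qed

lemma pair_sum_attach_last:
  assumes "1 \<le> p" "z \<in> C" "w \<in> C"
    and "\<And>\<kappa>. g (\<kappa>(Suc p := w)) = of_bool (\<kappa> p \<noteq> w) * f \<kappa>"
  shows "pair_sum (Suc p) g z w = of_bool (z \<noteq> w) * (x z * rooted_sum p f z)"
proof -
  have "(\<Sum>\<kappa>\<in>Pi\<^sub>E {1..p} (\<lambda>_. C). of_bool (\<kappa> p = z) * cst (g (\<kappa>(Suc p := w))) * (\<Prod>i\<in>{1..<p}. x (\<kappa> i)))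
     = of_bool (z \<noteq> w) * rooted_sum p f z"
    unfolding rooted_sum_def sum_distrib_left assms(4) cst_mult cst_of_bool
    by (intro sum.cong) auto
  then show ?thesis using pair_sum_Suc[OF assms(1,3)] by (simp add: mult_ac)
qed

lemma pair_sum_attach_last_two:
  assumes "2 \<le> p" "z \<in> C" "w \<in> C"
    and "\<And>\<kappa>. g (\<kappa>(Suc p := w)) = of_bool (\<kappa> p \<noteq> w) * of_bool (\<kappa> (p - 1) \<noteq> w) * f \<kappa>"
  shows "pair_sum (Suc p) g z w = of_bool (z \<noteq> w) * (x z * (\<Sum>y\<in>C - {w}. pair_sum p f y z))"
proof -
  have "(\<Sum>\<kappa>\<in>Pi\<^sub>E {1..p} (\<lambda>_. C). of_bool (\<kappa> p = z) * cst (g (\<kappa>(Suc p := w))) * (\<Prod>i\<in>{1..<p}. x (\<kappa> i)))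
     = of_bool (z \<noteq> w) * (\<Sum>y\<in>C - {w}. pair_sum p f y z)"
    unfolding pair_sum_def
  proof (subst sum.swap, subst sum_distrib_left, rule sum.cong[OF refl])
    fix \<kappa> assume k: "\<kappa> \<in> Pi\<^sub>E {1..p} (\<lambda>_. C)"
    have "p - 1 \<in> {1..p}" using assms by auto
    from PiE_mem[OF k this] have kp: "\<kappa> (p - 1) \<in> C" .
    let ?t = "of_bool (\<kappa> p = z) * cst (f \<kappa>) * (\<Prod>i\<in>{1..<p}. x (\<kappa> i))"
    have "(\<Sum>y\<in>C - {w}. of_bool (\<kappa> (p - 1) = y) * ?t) = of_bool (\<kappa> (p - 1) \<noteq> w) * ?t"
    proof (cases "\<kappa> (p - 1) = w")
      case True
      then have "\<kappa> (p - 1) \<notin> C - {w}" by simp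
      from sum_of_bool_eq_notin[OF this, of ?t] True show ?thesis by simp
    next
      case False
      then have "\<kappa> (p - 1) \<in> C - {w}" using kp by simp
      from sum_of_bool_eq_in[OF _ this, of ?t] False fin show ?thesis by simp
    qed
    then have "(\<Sum>y\<in>C - {w}. of_bool (\<kappa> (p - 1) = y) * of_bool (\<kappa> p = z) * cst (f \<kappa>) * (\<Prod>i\<in>{1..<p}. x (\<kappa> i)))
       = of_bool (\<kappa> (p - 1) \<noteq> w) * ?t" by (simp only: mult.assoc)
    then show "of_bool (\<kappa> p = z) * cst (g (\<kappa>(Suc p := w))) * (\<Prod>i\<in>{1..<p}. x (\<kappa> i))
      = of_bool (z \<noteq> w) * (\<Sum>y\<in>C - {w}. of_bool (\<kappa> (p - 1) = y) * of_bool (\<kappa> p = z) * cst (f \<kappa>) * (\<Prod>i\<in>{1..<p}. x (\<kappa> i)))"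
      unfolding assms(4) cst_mult cst_of_bool by auto
  qed
  then show ?thesis using pair_sum_Suc[of p w g z] assms by (simp add: mult_ac)
qed

definition rooted_positive :: "nat \<Rightarrow> ((nat \<Rightarrow> nat) \<Rightarrow> real) \<Rightarrow> bool" where
  "rooted_positive p f \<longleftrightarrow> (\<exists>F. pos1 p F \<and> (\<forall>a\<in>C. rooted_sum p f a = F (x a)))"

text \<open>\<open>F\<close> is prescribed at distinct colours only, because the last two vertices
  are adjacent. The factor \<open>x y\<close> is the letter of vertex \<open>p - 1\<close>, the same
  factor that \<open>tr\<close> supplies in \<open>collapse\<close> and
  \<open>extend\<close>.\<close>

definition pair_positive :: "nat \<Rightarrow> ((nat \<Rightarrow> nat) \<Rightarrow> real) \<Rightarrow> bool" where
  "pair_positive p f \<longleftrightarrow> (\<exists>F. pos2 p F \<and>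
     (\<forall>y\<in>C. \<forall>z\<in>C. pair_sum p f y z = of_bool (y \<noteq> z) * (x y * F (x y) (x z))))"

lemma pair_positive_attach_last:
  assumes "1 \<le> p" "rooted_positive p f"
    and "\<And>\<kappa> w. g (\<kappa>(Suc p := w)) = of_bool (\<kappa> p \<noteq> w) * f \<kappa>"
  shows "pair_positive (Suc p) g"
proof -
  obtain F where F: "pos1 p F" "\<And>a. a \<in> C \<Longrightarrow> rooted_sum p f a = F (x a)"
    using assms(2) unfolding rooted_positive_def by blast
  show ?thesis
    unfolding pair_positive_def
    by (intro exI[of _ "\<lambda>y z. F y"] conjI pos2_of_pos1 F ballI)
       (simp add: pair_sum_attach_last[OF assms(1) _ _ assms(3)] F)
qed

lemma pair_positive_attach_last_two:
  assumes "2 \<le> p" "pair_positive p f"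
    and "\<And>\<kappa> w. g (\<kappa>(Suc p := w)) = of_bool (\<kappa> p \<noteq> w) * of_bool (\<kappa> (p - 1) \<noteq> w) * f \<kappa>"
  shows "pair_positive (Suc p) g"
proof -
  obtain F where F: "pos2 p F"
    "\<And>y z. y \<in> C \<Longrightarrow> z \<in> C \<Longrightarrow> pair_sum p f y z = of_bool (y \<noteq> z) * (x y * F (x y) (x z))"
    using assms(2) unfolding pair_positive_def by blast
  have "pair_sum (Suc p) g z w = of_bool (z \<noteq> w) * (x z * extend F (x z) (x w))" if "z \<in> C" "w \<in> C" for z w
  proof (cases "z = w")
    case True
    then show ?thesis using pair_sum_attach_last_two[OF assms(1) that assms(3)] by simp
  next
    case False
    have "(\<Sum>y\<in>C - {w}. pair_sum p f y z) = (\<Sum>y\<in>C - {w}. of_bool (y \<noteq> z) * (x y * F (x y) (x z)))"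
      using that by (intro sum.cong) (auto simp: F)
    also have "\<dots> = (\<Sum>y\<in>C - {z, w}. x y * F (x y) (x z))"
      using fin by (intro sum.mono_neutral_cong_right) auto
    also have "\<dots> = extend F (x z) (x w)"
      using extend_at_letters[OF that False] by simp
    finally show ?thesis
      using pair_sum_attach_last_two[OF assms(1) that assms(3)] by simp
  qed
  then show ?thesis
    unfolding pair_positive_def using pos2_extend[OF F(1)] by blast
qed

lemma rooted_positive_of_pair_positive:
  assumes "2 \<le> p" "pair_positive p f"
  shows "rooted_positive p f"
proof -
  obtain F where F: "pos2 p F"
    "\<And>y z. y \<in> C \<Longrightarrow> z \<in> C \<Longrightarrow> pair_sum p f y z = of_bool (y \<noteq> z) * (x y * F (x y) (x z))"
    using assms(2) unfolding pair_positive_def by blast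
  have "rooted_sum p f z = collapse F (x z)" if "z \<in> C" for z
  proof -
    have "rooted_sum p f z = (\<Sum>y\<in>C. of_bool (y \<noteq> z) * (x y * F (x y) (x z)))"
      unfolding rooted_sum_pair_sum[OF assms(1)] using that by (intro sum.cong) (auto simp: F)
    also have "\<dots> = (\<Sum>y\<in>C - {z}. x y * F (x y) (x z))"
      using fin by (intro sum.mono_neutral_cong_right) auto
    finally show ?thesis using collapse_at_letter[OF that] by simp
  qed
  then show ?thesis
    unfolding rooted_positive_def using pos1_collapse[OF F(1)] by blast
qed

end

section \<open>Triangular ladders built vertex by vertex\<close>

lemma proper_coloring_Un: "proper_coloring (E \<union> F) \<kappa> \<longleftrightarrow> proper_coloring E \<kappa> \<and> proper_coloring F \<kappa>"
  unfolding proper_coloring_def by blast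

lemma proper_coloring_edge: "a \<noteq> b \<Longrightarrow> proper_coloring {{a, b}} \<kappa> \<longleftrightarrow> \<kappa> a \<noteq> \<kappa> b"
  unfolding proper_coloring_def by (auto simp: doubleton_eq_iff)

lemma proper_coloring_cong:
  "(\<And>i. i \<in> \<Union>E \<Longrightarrow> \<kappa> i = \<kappa>' i) \<Longrightarrow> proper_coloring E \<kappa> \<longleftrightarrow> proper_coloring E \<kappa>'"
  unfolding proper_coloring_def by (metis UnionI insertI1 insert_commute)

lemma TL_1: "TL 1 = {}"
  by (auto simp: TL_def)

lemma TL_2: "TL 2 = {{1, 2}}"
  by (force simp: TL_def)

lemma TL_Suc:
  assumes "2 \<le> m"
  shows "TL (Suc m) = TL m \<union> {{m, Suc m}} \<union> {{m - 1, Suc m}}" (is "?L = ?R")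
proof
  show "?L \<subseteq> ?R"
  proof
    fix e assume "e \<in> ?L"
    then obtain i j where ij: "e = {i, j}" "i \<in> {1..Suc m}" "j \<in> {1..Suc m}" "i < j" "j \<le> i + 2"
      unfolding TL_def by blast
    show "e \<in> ?R"
    proof (cases "j = Suc m")
      case True
      then have "i = m \<or> i = m - 1" using ij by auto
      then show ?thesis using ij(1) True by auto
    next
      case False
      then have "i \<in> {1..m}" "j \<in> {1..m}" using ij by auto
      then have "e \<in> TL m" unfolding TL_def using ij(1,4,5) by blast
      then show ?thesis by simp
    qed
  qed
  have "{1..m} \<subseteq> {1..Suc m}" by auto
  then have "TL m \<subseteq> TL (Suc m)" unfolding TL_def by blast
  moreover have TL_I: "{i, Suc m} \<in> TL (Suc m)" if "1 \<le> i" "i < Suc m" "Suc m \<le> i + 2" for i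
  proof -
    have "i \<in> {1..Suc m}" "Suc m \<in> {1..Suc m}" using that by auto
    then show ?thesis unfolding TL_def using that by blast
  qed
  moreover have "{m, Suc m} \<in> TL (Suc m)" "{m - 1, Suc m} \<in> TL (Suc m)"
    using assms by (auto intro: TL_I)
  ultimately show "?R \<subseteq> ?L" by simp
qed

lemma graph_concat_TL_1: "graph_concat n E (TL 1) = E"
  unfolding graph_concat_def TL_1 by simp

lemma graph_concat_TL_2:
  assumes "1 \<le> n"
  shows "graph_concat n E (TL 2) = E \<union> {{n, Suc n}}"
  using assms by (simp add: graph_concat_def TL_2)

lemma graph_concat_TL_Suc:
  assumes "1 \<le> n" "2 \<le> m" "p = n + m - 1"
  shows "graph_concat n E (TL (Suc m)) = graph_concat n E (TL m) \<union> {{p, Suc p}} \<union> {{p - 1, Suc p}}"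
proof -
  have "m + n - 1 = p" "Suc m + n - 1 = Suc p" "m - 1 + n - 1 = p - 1" using assms by auto
  then show ?thesis
    unfolding graph_concat_def TL_Suc[OF assms(2)] image_Un by auto
qed

lemma vertices_graph_concat_TL:
  assumes "simple_graph n E" "1 \<le> n" "1 \<le> m"
  shows "\<Union>(graph_concat n E (TL m)) \<subseteq> {1..n + m - 1}"
proof -
  have "e \<subseteq> {1..n}" if "e \<in> E" for e
    using assms(1) that unfolding simple_graph_def by force
  then have "\<Union>E \<subseteq> {1..n + m - 1}" using assms by fastforce
  moreover have "\<Union>((\<lambda>e. (\<lambda>i. i + n - 1) ` e) ` TL m) \<subseteq> {1..n + m - 1}"
    using assms by (auto simp: TL_def)
  ultimately show ?thesis unfolding graph_concat_def by blast
qed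

lemma YG_add_edge:
  assumes "a \<noteq> b"
  shows "YG (E \<union> {{a, b}}) \<kappa> = of_bool (\<kappa> a \<noteq> \<kappa> b) * YG E \<kappa>"
  unfolding YG_def proper_coloring_Un proper_coloring_edge[OF assms] by auto

lemma YG_cong: "(\<And>i. i \<in> \<Union>E \<Longrightarrow> \<kappa> i = \<kappa>' i) \<Longrightarrow> YG E \<kappa> = YG E \<kappa>'"
  using proper_coloring_cong[of E \<kappa> \<kappa>'] by (simp add: YG_def)

lemma (in colour_alphabet) rooted_positive_concat_TL:
  assumes "simple_graph n G" "1 \<le> n" "rooted_positive n (YG G)" "1 \<le> m"
  shows "rooted_positive (n + m - 1) (YG (graph_concat n G (TL m)))"
proof -
  have fresh: "YG (graph_concat n G (TL m)) (\<kappa>(Suc (n + m - 1) := w)) = YG (graph_concat n G (TL m)) \<kappa>"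
    if "1 \<le> m" for m \<kappa> w
    by (rule YG_cong) (use vertices_graph_concat_TL[OF assms(1,2) that] in auto)
  \<comment> \<open>The induction starts at m = 2: the first new vertex has vertex n as its only
    neighbour, and only then are the last two vertices known to be adjacent.\<close>
  have pair: "pair_positive (n + m - 1) (YG (graph_concat n G (TL m)))" if "2 \<le> m" for m
    using that
  proof (induction m rule: dec_induct)
    case base
    have "pair_positive (Suc n) (YG (graph_concat n G (TL 2)))"
    proof (rule pair_positive_attach_last[OF assms(2,3)])
      fix \<kappa> :: "nat \<Rightarrow> nat" and w
      show "YG (graph_concat n G (TL 2)) (\<kappa>(Suc n := w)) = of_bool (\<kappa> n \<noteq> w) * YG G \<kappa>"
        unfolding graph_concat_TL_2[OF assms(2)] YG_add_edge[OF n_not_Suc_n] using fresh[of 1 \<kappa> w] assms(2)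
        by (simp add: graph_concat_TL_1[simplified])
    qed
    then show ?case by simp
  next
    case (step m)
    let ?p = "n + m - 1"
    have p: "2 \<le> ?p" "n + Suc m - 1 = Suc ?p" using step assms by auto
    show ?case
      unfolding p(2)
    proof (rule pair_positive_attach_last_two[OF p(1) step.IH])
      fix \<kappa> :: "nat \<Rightarrow> nat" and w
      have "?p - 1 \<noteq> Suc ?p" "?p - 1 \<noteq> ?p" using p(1) by auto
      then show "YG (graph_concat n G (TL (Suc m))) (\<kappa>(Suc ?p := w))
        = of_bool (\<kappa> ?p \<noteq> w) * of_bool (\<kappa> (?p - 1) \<noteq> w) * YG (graph_concat n G (TL m)) \<kappa>"
        unfolding graph_concat_TL_Suc[OF assms(2) step(1) refl] YG_add_edge[OF n_not_Suc_n] YG_add_edge[OF \<open>?p - 1 \<noteq> Suc ?p\<close>]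
        using fresh[of m \<kappa> w] step(1) assms(2) by auto
    qed
  qed
  show ?thesis
  proof (cases "m = 1")
    case True
    then show ?thesis using assms(3) by (simp add: graph_concat_TL_1[simplified])
  next
    case False
    then show ?thesis
      using assms by (intro rooted_positive_of_pair_positive pair) auto
  qed
qed

section \<open>From set partitions to the cones and back\<close>

context colour_alphabet
begin

definition type_weight :: "nat multiset \<times> nat \<Rightarrow> nat \<Rightarrow> 'r" where
  "type_weight t a = prod_mset (image_mset (\<lambda>k. fact k * e k) (fst t - {#snd t#}))
     * (fact (snd t - 1) * E (snd t) (x a))"

lemma rooted_sum_e_basis:
  assumes "\<pi> \<in> set_partitions n" "1 \<le> n" "a \<in> C"
  shows "rooted_sum n (e_basis \<pi>) a
    = blocks_weight (\<pi> - {block_of \<pi> n}) * (fact (card (block_of \<pi> n) - 1) * E (card (block_of \<pi> n)) (x a))"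
proof -
  have "e_basis \<pi> = (\<lambda>\<kappa>. of_bool (\<forall>B\<in>\<pi>. inj_on \<kappa> B))" by (simp add: e_basis_def fun_eq_iff)
  then show ?thesis
    using rooted_sum_inj_on_blocks[of n \<pi> a] assms by (simp add: set_partitions_def)
qed

lemma rooted_sum_e_basis_type:
  assumes "\<pi> \<in> set_partitions n" "1 \<le> n" "a \<in> C"
  shows "rooted_sum n (e_basis \<pi>) a = type_weight (block_type n \<pi>) a"
proof -
  have p: "partition_on {1..n} \<pi>" using assms by (simp add: set_partitions_def)
  then have "finite \<pi>" using finite_elements by blast
  moreover have "block_of \<pi> n \<in> \<pi>" using block_of[OF p] assms by auto
  ultimately show ?thesis
    unfolding rooted_sum_e_basis[OF assms] type_weight_def block_type_def
    by (simp add: blocks_weight_remove)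
qed

lemma rooted_sum_e_expansion:
  assumes "e_expansion n f c"
  shows "rooted_sum n f a = (\<Sum>\<pi>\<in>set_partitions n. cst (c \<pi>) * rooted_sum n (e_basis \<pi>) a)"
proof -
  have "rooted_sum n f a = rooted_sum n (\<lambda>\<kappa>. \<Sum>\<pi>\<in>set_partitions n. c \<pi> * e_basis \<pi> \<kappa>) a"
  proof (rule rooted_sum_cong)
    fix \<kappa> assume "\<kappa> \<in> Pi\<^sub>E {1..n} (\<lambda>_. C)"
    then have "\<kappa> \<in> words n" unfolding words_def using C_pos by (auto simp: PiE_iff)
    then show "f \<kappa> = (\<Sum>\<pi>\<in>set_partitions n. c \<pi> * e_basis \<pi> \<kappa>)"
      using assms by (simp add: e_expansion_def)
  qed
  then show ?thesis by (simp add: rooted_sum_sum)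
qed

text \<open>The image of \<open>e_basis \<pi>\<close> depends only on the block type, so
  coefficients enter through their class sums. This lets a rooted sum be computed from the
  nonnegative side of \<open>sym_equiv\<close>.\<close>

lemma rooted_sum_class_sums:
  assumes "1 \<le> n" "a \<in> C"
    and "\<And>\<pi>. \<pi> \<in> set_partitions n \<Longrightarrow> (\<Sum>\<sigma>\<in>{\<sigma>\<in>set_partitions n. part_sim n \<pi> \<sigma>}. c \<sigma>)
       = (\<Sum>\<sigma>\<in>{\<sigma>\<in>set_partitions n. part_sim n \<pi> \<sigma>}. d \<sigma>)"
  shows "(\<Sum>\<pi>\<in>set_partitions n. cst (c \<pi>) * rooted_sum n (e_basis \<pi>) a)
       = (\<Sum>\<pi>\<in>set_partitions n. cst (d \<pi>) * rooted_sum n (e_basis \<pi>) a)"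
proof -
  let ?P = "set_partitions n"
  have group: "(\<Sum>\<pi>\<in>?P. cst (c \<pi>) * rooted_sum n (e_basis \<pi>) a)
    = (\<Sum>t\<in>block_type n ` ?P. cst (\<Sum>\<pi>\<in>{\<pi>\<in>?P. block_type n \<pi> = t}. c \<pi>) * type_weight t a)" for c
  proof -
    have "(\<Sum>\<pi>\<in>?P. cst (c \<pi>) * rooted_sum n (e_basis \<pi>) a)
      = (\<Sum>\<pi>\<in>?P. cst (c \<pi>) * type_weight (block_type n \<pi>) a)"
      by (intro sum.cong refl) (simp only: rooted_sum_e_basis_type[OF _ assms(1,2)])
    also have "\<dots> = (\<Sum>t\<in>block_type n ` ?P. \<Sum>\<pi>\<in>{\<pi>\<in>?P. block_type n \<pi> = t}.
        cst (c \<pi>) * type_weight (block_type n \<pi>) a)"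
      by (rule sum.image_gen[OF finite_set_partitions])
    also have "\<dots> = (\<Sum>t\<in>block_type n ` ?P. \<Sum>\<pi>\<in>{\<pi>\<in>?P. block_type n \<pi> = t}. cst (c \<pi>) * type_weight t a)"
      by (intro sum.cong refl) simp
    finally show ?thesis by (simp add: cst_sum sum_distrib_right)
  qed
  have "(\<Sum>\<pi>\<in>{\<pi>\<in>?P. block_type n \<pi> = t}. c \<pi>) = (\<Sum>\<pi>\<in>{\<pi>\<in>?P. block_type n \<pi> = t}. d \<pi>)"
    if t: "t \<in> block_type n ` ?P" for t
  proof -
    obtain \<pi> where \<pi>: "\<pi> \<in> ?P" "t = block_type n \<pi>" using t by blast
    then show ?thesis
      using assms(3)[OF \<pi>(1)] by (simp add: part_sim_iff eq_commute)
  qed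
  then show ?thesis unfolding group by (intro sum.cong refl) simp
qed

lemma epos_fact_e:
  "epos d r \<Longrightarrow> epos (d + k) (fact k * e k * r)"
  using epos_of_nat[OF epos_e, of d r k "fact k"] by (simp add: mult_ac)

lemma epos_blocks_weight:
  "finite \<tau> \<Longrightarrow> epos (\<Sum>B\<in>\<tau>. card B) (blocks_weight \<tau>)"
proof (induction \<tau> rule: finite_induct)
  case empty
  then show ?case by (simp add: blocks_weight_def epos_1)
next
  case (insert B \<tau>)
  then show ?case
    using epos_fact_e[OF insert.IH, of "card B"] by (simp add: blocks_weight_def add.commute mult.assoc)
qed

lemma rooted_positive_of_semi_sym_e_positive:
  assumes "semi_sym_e_positive n G" "1 \<le> n"
  shows "rooted_positive n (YG G)"
proof -
  let ?P = "set_partitions n"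
  obtain d cf cg where d: "\<And>\<pi>. \<pi> \<in> ?P \<Longrightarrow> 0 \<le> d \<pi>"
    and cf: "e_expansion n (YG G) cf"
    and cg: "e_expansion n (\<lambda>\<kappa>. \<Sum>\<pi>\<in>?P. d \<pi> * e_basis \<pi> \<kappa>) cg"
    and eq: "\<And>\<pi>. \<pi> \<in> ?P \<Longrightarrow> (\<Sum>\<sigma>\<in>{\<sigma>\<in>?P. part_sim n \<pi> \<sigma>}. cf \<sigma>) = (\<Sum>\<sigma>\<in>{\<sigma>\<in>?P. part_sim n \<pi> \<sigma>}. cg \<sigma>)"
    using assms(1) unfolding semi_sym_e_positive_def sym_equiv_def by blast
  let ?r = "\<lambda>\<pi>. cst (d \<pi>) * (fact (card (block_of \<pi> n) - 1) * blocks_weight (\<pi> - {block_of \<pi> n}))"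
  let ?F = "\<lambda>z. \<Sum>\<pi>\<in>?P. ?r \<pi> * E (card (block_of \<pi> n)) z"
  have "rooted_sum n (YG G) a = ?F (x a)" if "a \<in> C" for a
  proof -
    have "rooted_sum n (YG G) a = (\<Sum>\<pi>\<in>?P. cst (cf \<pi>) * rooted_sum n (e_basis \<pi>) a)"
      by (rule rooted_sum_e_expansion[OF cf])
    also have "\<dots> = (\<Sum>\<pi>\<in>?P. cst (cg \<pi>) * rooted_sum n (e_basis \<pi>) a)"
      using assms(2) that eq by (rule rooted_sum_class_sums)
    also have "\<dots> = rooted_sum n (\<lambda>\<kappa>. \<Sum>\<pi>\<in>?P. d \<pi> * e_basis \<pi> \<kappa>) a"
      by (rule rooted_sum_e_expansion[OF cg, symmetric])
    also have "\<dots> = (\<Sum>\<pi>\<in>?P. cst (d \<pi>) * rooted_sum n (e_basis \<pi>) a)"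
      by (rule rooted_sum_sum)
    also have "\<dots> = ?F (x a)"
      by (intro sum.cong refl) (simp only: rooted_sum_e_basis[OF _ assms(2) that] mult_ac)
    finally show ?thesis .
  qed
  moreover have "pos1 n ?F"
  proof (rule pos1_sum[OF finite_set_partitions])
    fix \<pi> assume \<pi>: "\<pi> \<in> ?P"
    let ?R = "block_of \<pi> n"
    have p: "partition_on {1..n} \<pi>" using \<pi> by (simp add: set_partitions_def)
    then have f: "finite \<pi>" using finite_elements by blast
    have R: "?R \<in> \<pi>" "n \<in> ?R" using block_of[OF p] assms by auto
    have fB: "finite B" if "B \<in> \<pi>" for B
      using that p by (metis Sup_upper finite_atLeastAtMost finite_subset partition_onD1)
    \<comment> \<open>The block sizes add up to the index that \<open>pos1\<close> tracks.\<close>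
    have "n = (\<Sum>B\<in>\<pi>. card B)" using product_partition[OF p fB] by simp
    also have "\<dots> = (\<Sum>B\<in>\<pi> - {?R}. card B) + card ?R"
      using sum.remove[OF f R(1), of card] by simp
    finally have n: "n = \<dots>" .
    have "card ?R > 0" using R fB by (auto simp: card_gt_0_iff)
    then have "pos1 ((\<Sum>B\<in>\<pi> - {?R}. card B) + card ?R) (\<lambda>z. ?r \<pi> * E (card ?R) z)"
      using f d[OF \<pi>] epos_of_nat[OF epos_blocks_weight, of "\<pi> - {?R}" "fact (card ?R - 1)"]
      by (intro pos1_E epos_scale) simp_all
    then show "pos1 n (\<lambda>z. ?r \<pi> * E (card ?R) z)" using n by simp
  qed
  ultimately show ?thesis unfolding rooted_positive_def by blast
qed

section \<open>Elements of the cone as nonnegative combinations of images of set partitions\<close>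

definition realizable :: "nat \<Rightarrow> ('r \<Rightarrow> 'r) \<Rightarrow> bool" where
  "realizable n F \<longleftrightarrow> (\<exists>d. (\<forall>\<pi>\<in>set_partitions n. 0 \<le> d \<pi>)
     \<and> (\<forall>a\<in>C. F (x a) = (\<Sum>\<pi>\<in>set_partitions n. cst (d \<pi>) * rooted_sum n (e_basis \<pi>) a)))"

lemma realizable_0: "realizable n (\<lambda>z. 0)"
  unfolding realizable_def by (rule exI[of _ "\<lambda>\<pi>. 0"]) (simp add: cst_0)

lemma realizable_add:
  assumes "realizable n F" "realizable n G"
  shows "realizable n (\<lambda>z. F z + G z)"
proof -
  obtain c d where "\<forall>\<pi>\<in>set_partitions n. 0 \<le> c \<pi>" "\<forall>\<pi>\<in>set_partitions n. 0 \<le> d \<pi>"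
    "\<forall>a\<in>C. F (x a) = (\<Sum>\<pi>\<in>set_partitions n. cst (c \<pi>) * rooted_sum n (e_basis \<pi>) a)"
    "\<forall>a\<in>C. G (x a) = (\<Sum>\<pi>\<in>set_partitions n. cst (d \<pi>) * rooted_sum n (e_basis \<pi>) a)"
    using assms unfolding realizable_def by blast
  then show ?thesis
    unfolding realizable_def
    by (intro exI[of _ "\<lambda>\<pi>. c \<pi> + d \<pi>"]) (simp add: cst_add distrib_right sum.distrib)
qed

lemma realizable_scale:
  assumes "0 \<le> c" "realizable n F"
  shows "realizable n (\<lambda>z. cst c * F z)"
proof -
  obtain d where "\<forall>\<pi>\<in>set_partitions n. 0 \<le> d \<pi>"
    "\<forall>a\<in>C. F (x a) = (\<Sum>\<pi>\<in>set_partitions n. cst (d \<pi>) * rooted_sum n (e_basis \<pi>) a)"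
    using assms(2) unfolding realizable_def by blast
  then show ?thesis
    unfolding realizable_def using assms(1)
    by (intro exI[of _ "\<lambda>\<pi>. c * d \<pi>"]) (simp add: cst_mult sum_distrib_left mult.assoc)
qed

lemma realizable_cong:
  "realizable n F \<Longrightarrow> (\<And>a. a \<in> C \<Longrightarrow> F (x a) = G (x a)) \<Longrightarrow> realizable n G"
  unfolding realizable_def by simp

lemma realizable_e_basis:
  assumes "\<pi> \<in> set_partitions n" "\<And>a. a \<in> C \<Longrightarrow> F (x a) = rooted_sum n (e_basis \<pi>) a"
  shows "realizable n F"
proof -
  have "(\<Sum>\<sigma>\<in>set_partitions n. cst (of_bool (\<sigma> = \<pi>)) * rooted_sum n (e_basis \<sigma>) a)
     = (\<Sum>\<sigma>\<in>set_partitions n. if \<sigma> = \<pi> then rooted_sum n (e_basis \<pi>) a else 0)" for a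
    by (intro sum.cong) (auto simp: cst_of_bool)
  also have "\<dots> a = rooted_sum n (e_basis \<pi>) a" for a
    using assms(1) finite_set_partitions by simp
  finally show ?thesis
    unfolding realizable_def using assms(2) by (intro exI[of _ "\<lambda>\<sigma>. of_bool (\<sigma> = \<pi>)"]) simp
qed

lemma realizable_sum:
  "finite I \<Longrightarrow> (\<And>i. i \<in> I \<Longrightarrow> realizable n (F i)) \<Longrightarrow> realizable n (\<lambda>z. \<Sum>i\<in>I. F i z)"
  by (induction I rule: finite_induct) (auto intro: realizable_0 realizable_add)

text \<open>The new block \<open>{1..j}\<close> goes in front and the old partition is shifted by j.
  The last vertex moves along with its block, so only the product over the other blocks gains a
  factor.\<close>

lemma set_partition_prepend_block:
  assumes "\<pi> \<in> set_partitions n" "1 \<le> n" "1 \<le> j"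
  shows "\<exists>\<sigma>\<in>set_partitions (n + j). \<forall>a\<in>C.
    rooted_sum (n + j) (e_basis \<sigma>) a = fact j * e j * rooted_sum n (e_basis \<pi>) a"
proof -
  let ?s = "\<lambda>i. i + j"
  let ?\<sigma> = "insert {1..j} ((`) ?s ` \<pi>)"
  have p: "partition_on {1..n} \<pi>" using assms by (simp add: set_partitions_def)
  have f: "finite \<pi>" using finite_elements[OF _ p] by simp
  have ne: "B \<noteq> {}" if "B \<in> \<pi>" for B using that p partition_onD3 by blast
  have img: "?s ` {1..n} = {j + 1..n + j}" by (auto simp: image_add_atLeastAtMost' add_ac)
  have "partition_on (?s ` {1..n}) ((`) ?s ` \<pi> - {{}})"
    by (rule partition_on_inj_image[OF p]) simp
  moreover have "(`) ?s ` \<pi> - {{}} = (`) ?s ` \<pi>" using ne by auto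
  ultimately have "partition_on {j + 1..n + j} ((`) ?s ` \<pi>)" using img by simp
  then have "partition_on ({1..j} \<union> {j + 1..n + j}) ({{1..j}} \<union> (`) ?s ` \<pi>)"
    by (intro partition_on_Un partition_on_space) (use assms in auto)
  moreover have "{1..j} \<union> {j + 1..n + j} = {1..n + j}" by auto
  ultimately have ps: "partition_on {1..n + j} ?\<sigma>" by simp
  let ?R = "block_of \<pi> n"
  have R: "?R \<in> \<pi>" "n \<in> ?R" using block_of[OF p] assms by auto
  have bs: "block_of ?\<sigma> (n + j) = ?s ` ?R"
    by (rule block_of_eq[OF ps]) (use R in auto)
  have inj: "inj_on ((`) ?s) S" for S :: "nat set set"
    by (rule inj_on_image) (auto simp: inj_on_def)
  have nin: "{1..j} \<notin> (`) ?s ` \<pi>'" if sub: "\<pi>' \<subseteq> \<pi>" for \<pi>'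
  proof
    assume "{1..j} \<in> (`) ?s ` \<pi>'"
    then obtain B where B: "B \<in> \<pi>" "{1..j} = ?s ` B" using sub by blast
    then obtain i where "i \<in> B" using ne by blast
    then have "i + j \<in> {1..j}" using B by blast
    moreover have "i \<in> {1..n}" using \<open>i \<in> B\<close> B(1) p by (auto simp: partition_on_def)
    ultimately show False by simp
  qed
  have "{1..j} \<noteq> ?s ` ?R" using nin[of \<pi>] R by blast
  then have "?\<sigma> - {?s ` ?R} = insert {1..j} ((`) ?s ` \<pi> - {?s ` ?R})" by auto
  also have "(`) ?s ` \<pi> - {?s ` ?R} = (`) ?s ` (\<pi> - {?R})"
    using inj_on_image_set_diff[OF inj[of \<pi>], of \<pi> "{?R}"] R by simp
  finally have rem: "?\<sigma> - {?s ` ?R} = insert {1..j} ((`) ?s ` (\<pi> - {?R}))" .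
  have cs: "card (?s ` B) = card B" for B by (rule card_image) simp
  have bw: "blocks_weight (?\<sigma> - {?s ` ?R}) = fact j * e j * blocks_weight (\<pi> - {?R})"
    unfolding rem blocks_weight_def using nin[of "\<pi> - {?R}"] f
    by (simp add: prod.reindex[OF inj] cs)
  have sp: "?\<sigma> \<in> set_partitions (n + j)" using ps by (simp add: set_partitions_def)
  have "rooted_sum (n + j) (e_basis ?\<sigma>) a = fact j * e j * rooted_sum n (e_basis \<pi>) a" if "a \<in> C" for a
  proof -
    have "1 \<le> n + j" using assms by simp
    show ?thesis
      unfolding rooted_sum_e_basis[OF sp \<open>1 \<le> n + j\<close> that] rooted_sum_e_basis[OF assms(1,2) that]
        bs bw cs by (simp only: mult.assoc)
  qed
  then show ?thesis using sp by blast
qed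

lemma cst_fact: "cst (fact k) = fact k"
  using cst_of_nat[of "fact k"] by simp

lemma cst_inverse_fact: "cst (1 / fact k) * (fact k * r) = r"
proof -
  have "cst (1 / fact k) * fact k = cst (1 / fact k * fact k)"
    by (simp only: cst_mult cst_fact)
  then show ?thesis by (simp add: cst_1 mult.assoc[symmetric])
qed

text \<open>Prepending a block of size j multiplies by \<open>fact j * e j\<close>; the factorial is
  divided out of the real coefficients.\<close>

lemma realizable_e:
  assumes "realizable n F" "1 \<le> n"
  shows "realizable (n + j) (\<lambda>z. e j * F z)"
\<comment> \<open>For j = 0 the prepended \<open>{1..j}\<close> would be empty, hence no block;
  multiplication by \<open>e 0 = 1\<close> changes nothing.\<close>
proof (cases "j = 0")
  case True
  then show ?thesis using assms by (simp add: e_0)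
next
  case False
  let ?P = "set_partitions n"
  obtain d where d: "\<forall>\<pi>\<in>?P. 0 \<le> d \<pi>"
    "\<forall>a\<in>C. F (x a) = (\<Sum>\<pi>\<in>?P. cst (d \<pi>) * rooted_sum n (e_basis \<pi>) a)"
    using assms(1) unfolding realizable_def by blast
  let ?w = "\<lambda>\<pi> z. blocks_weight (\<pi> - {block_of \<pi> n}) * (fact (card (block_of \<pi> n) - 1) * E (card (block_of \<pi> n)) z)"
  have "realizable (n + j) (\<lambda>z. \<Sum>\<pi>\<in>?P. cst (d \<pi> / fact j) * (fact j * e j * ?w \<pi> z))"
  proof (intro realizable_sum realizable_scale finite_set_partitions)
    fix \<pi> assume \<pi>: "\<pi> \<in> ?P"
    then show "0 \<le> d \<pi> / fact j" using d by simp
    obtain \<sigma> where \<sigma>: "\<sigma> \<in> set_partitions (n + j)"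
      "\<forall>a\<in>C. rooted_sum (n + j) (e_basis \<sigma>) a = fact j * e j * rooted_sum n (e_basis \<pi>) a"
      using set_partition_prepend_block[OF \<pi> assms(2), of j] False by auto
    show "realizable (n + j) (\<lambda>z. fact j * e j * ?w \<pi> z)"
    proof (rule realizable_e_basis[OF \<sigma>(1)])
      fix a assume a: "a \<in> C"
      show "fact j * e j * ?w \<pi> (x a) = rooted_sum (n + j) (e_basis \<sigma>) a"
        by (simp only: \<sigma>(2)[rule_format, OF a] rooted_sum_e_basis[OF \<pi> assms(2) a])
    qed
  qed
  then show ?thesis
  proof (rule realizable_cong)
    fix a assume a: "a \<in> C"
    have "cst (d \<pi> / fact j) * (fact j * e j * ?w \<pi> (x a)) = e j * (cst (d \<pi>) * rooted_sum n (e_basis \<pi>) a)"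
      if "\<pi> \<in> ?P" for \<pi>
    proof -
      have "cst (d \<pi> / fact j) = cst (d \<pi>) * cst (1 / fact j)"
        by (simp flip: cst_mult)
      then have "cst (d \<pi> / fact j) * (fact j * e j * ?w \<pi> (x a))
          = cst (d \<pi>) * (cst (1 / fact j) * (fact j * (e j * ?w \<pi> (x a))))"
        by (simp only: mult.assoc)
      then show ?thesis
        unfolding cst_inverse_fact rooted_sum_e_basis[OF that assms(2) a] by (simp only: mult_ac)
    qed
    then have "(\<Sum>\<pi>\<in>?P. cst (d \<pi> / fact j) * (fact j * e j * ?w \<pi> (x a)))
      = (\<Sum>\<pi>\<in>?P. e j * (cst (d \<pi>) * rooted_sum n (e_basis \<pi>) a))"
      by (rule sum.cong[OF refl])
    then show "(\<Sum>\<pi>\<in>?P. cst (d \<pi> / fact j) * (fact j * e j * ?w \<pi> (x a))) = e j * F (x a)"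
      using d(2) a by (simp add: sum_distrib_left)
  qed
qed

lemma realizable_epos_E:
  assumes "epos d r" "1 \<le> k"
  shows "realizable (d + k) (\<lambda>z. r * E k z)"
  using assms
proof (induction rule: epos.induct)
  case (epos_0 d)
  then show ?case by (simp add: realizable_0)
next
  case epos_1
  \<comment> \<open>The partition with one block has image
    \<open>fact (k - 1) * E k\<close>.\<close>
  let ?\<pi> = "{{1..k}}"
  have p: "partition_on {1..k} ?\<pi>" using assms(2) by (intro partition_on_space) auto
  have sp: "?\<pi> \<in> set_partitions k" using p by (simp add: set_partitions_def)
  have b: "block_of ?\<pi> k = {1..k}" by (rule block_of_eq[OF p]) (use assms(2) in auto)
  have "realizable k (\<lambda>z. fact (k - 1) * E k z)"
    using rooted_sum_e_basis[OF sp assms(2)] unfolding b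
    by (intro realizable_e_basis[OF sp]) (simp add: blocks_weight_def)
  then have "realizable k (\<lambda>z. cst (1 / fact (k - 1)) * (fact (k - 1) * E k z))"
    by (intro realizable_scale) simp_all
  then show ?case by (simp only: cst_inverse_fact add_0 mult_1)
next
  case (epos_add d r s)
  then show ?case using realizable_add[of "d + k"] by (simp add: distrib_right)
next
  case (epos_scale c d r)
  then show ?case using realizable_scale[of c "d + k"] by (simp add: mult.assoc)
next
  case (epos_e d r j)
  then show ?case using realizable_e[of "d + k" _ j] by (simp add: mult.assoc add_ac)
qed

lemma realizable_pos1: "pos1 n F \<Longrightarrow> realizable n F"
  by (induction rule: pos1.induct) (auto intro: realizable_0 realizable_add realizable_epos_E)

end

section \<open>Symmetrization\<close>

text \<open>A word with prescribed kernel that uses only elements of \<open>A\<close> as colours;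
  hence n letters suffice to tell apart all set partitions of [n].\<close>

definition min_colouring :: "nat set \<Rightarrow> nat set set \<Rightarrow> nat \<Rightarrow> nat" where
  "min_colouring A \<pi> = restrict (\<lambda>i. Min (block_of \<pi> i)) A"

lemma min_colouring_in_block:
  assumes "finite A" "partition_on A \<pi>" "i \<in> A"
  shows "min_colouring A \<pi> i \<in> block_of \<pi> i"
proof -
  have "block_of \<pi> i \<subseteq> A" using block_of(1)[OF assms(2,3)] assms(2) by (auto simp: partition_on_def)
  then have "finite (block_of \<pi> i)" using assms(1) finite_subset by blast
  then have "Min (block_of \<pi> i) \<in> block_of \<pi> i"
    using block_of(2)[OF assms(2,3)] by (intro Min_in) auto
  then show ?thesis using assms(3) by (simp add: min_colouring_def)
qed

lemma min_colouring_PiE: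
  assumes "finite A" "partition_on A \<pi>"
  shows "min_colouring A \<pi> \<in> Pi\<^sub>E A (\<lambda>_. A)"
proof (rule PiE_I)
  fix i assume "i \<in> A"
  then show "min_colouring A \<pi> i \<in> A"
    using min_colouring_in_block[OF assms] block_of(1)[OF assms(2)] assms(2)
    unfolding partition_on_def by blast
qed (simp add: min_colouring_def)

lemma kernel_min_colouring:
  assumes "finite A" "partition_on A \<pi>"
  shows "kernel_partition A (min_colouring A \<pi>) = \<pi>"
proof -
  have fib: "{j \<in> A. min_colouring A \<pi> j = min_colouring A \<pi> i} = block_of \<pi> i" if i: "i \<in> A" for i
  proof
    show "{j \<in> A. min_colouring A \<pi> j = min_colouring A \<pi> i} \<subseteq> block_of \<pi> i"
    proof
      fix j assume "j \<in> {j \<in> A. min_colouring A \<pi> j = min_colouring A \<pi> i}"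
      then have j: "j \<in> A" "min_colouring A \<pi> j = min_colouring A \<pi> i" by auto
      then have "min_colouring A \<pi> i \<in> block_of \<pi> j" "min_colouring A \<pi> i \<in> block_of \<pi> i"
        using min_colouring_in_block[OF assms] i by metis+
      then have "block_of \<pi> j = block_of \<pi> i"
        using block_of_eq[OF assms(2)] block_of(1)[OF assms(2)] i j(1) by metis
      then show "j \<in> block_of \<pi> i" using block_of(2)[OF assms(2) j(1)] by simp
    qed
    show "block_of \<pi> i \<subseteq> {j \<in> A. min_colouring A \<pi> j = min_colouring A \<pi> i}"
    proof
      fix j assume j: "j \<in> block_of \<pi> i"
      have "block_of \<pi> i \<in> \<pi>" using block_of(1)[OF assms(2) i] .
      then have "j \<in> A" "block_of \<pi> j = block_of \<pi> i"
        using j assms(2) block_of_eq[OF assms(2)] by (auto simp: partition_on_def)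
      then show "j \<in> {j \<in> A. min_colouring A \<pi> j = min_colouring A \<pi> i}"
        using i by (simp add: min_colouring_def)
    qed
  qed
  have "kernel_partition A (min_colouring A \<pi>) = block_of \<pi> ` A"
    unfolding kernel_partition_def by (intro image_cong refl fib)
  also have "\<dots> = \<pi>"
  proof
    show "block_of \<pi> ` A \<subseteq> \<pi>" using block_of(1)[OF assms(2)] by blast
    show "\<pi> \<subseteq> block_of \<pi> ` A"
    proof
      fix B assume B: "B \<in> \<pi>"
      then obtain i where i: "i \<in> B" using partition_onD3[OF assms(2)] by fastforce
      then have "i \<in> A" using B assms(2) by (auto simp: partition_on_def)
      then show "B \<in> block_of \<pi> ` A" using block_of_eq[OF assms(2) B i] by blast
    qed
  qed
  finally show ?thesis .
qed

section \<open>Permutations of the first n - 1 vertices\<close>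

lemma e_basis_compose:
  assumes "inj \<delta>"
  shows "e_basis \<pi> (\<kappa> \<circ> \<delta>) = e_basis ((`) \<delta> ` \<pi>) \<kappa>"
proof -
  have "inj_on (\<kappa> \<circ> \<delta>) B \<longleftrightarrow> inj_on \<kappa> (\<delta> ` B)" for B
    using assms by (intro comp_inj_on_iff[symmetric]) (rule inj_on_subset, auto)
  then show ?thesis by (simp add: e_basis_def)
qed

lemma set_partitions_image_permutes:
  assumes "\<delta> permutes {1..<n}" "\<pi> \<in> set_partitions n"
  shows "(`) \<delta> ` \<pi> \<in> set_partitions n"
proof -
  have p: "partition_on {1..n} \<pi>" using assms by (simp add: set_partitions_def)
  have d: "\<delta> permutes {1..n}" by (rule permutes_subset[OF assms(1)]) auto
  have "partition_on (\<delta> ` {1..n}) ((`) \<delta> ` \<pi> - {{}})"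
    by (rule partition_on_inj_image[OF p]) (rule permutes_inj_on[OF d])
  moreover have "(`) \<delta> ` \<pi> - {{}} = (`) \<delta> ` \<pi>" using partition_onD3[OF p] by auto
  ultimately show ?thesis by (simp only: set_partitions_def permutes_image[OF d] mem_Collect_eq)
qed

lemma block_type_image_permutes:
  assumes "\<delta> permutes {1..<n}" "\<pi> \<in> set_partitions n" "1 \<le> n"
  shows "block_type n ((`) \<delta> ` \<pi>) = block_type n \<pi>"
proof -
  have p: "partition_on {1..n} \<pi>" using assms by (simp add: set_partitions_def)
  have p': "partition_on {1..n} ((`) \<delta> ` \<pi>)"
    using set_partitions_image_permutes[OF assms(1,2)] by (simp add: set_partitions_def)
  have inj: "inj \<delta>" by (rule permutes_inj[OF assms(1)])
  have cs: "card (\<delta> ` B) = card B" for B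
    by (rule card_image) (rule inj_on_subset[OF inj], simp)
  have "inj_on ((`) \<delta>) \<pi>" by (rule inj_on_image) (rule inj_on_subset[OF inj], simp)
  then have "mset_set ((`) \<delta> ` \<pi>) = image_mset ((`) \<delta>) (mset_set \<pi>)"
    by (simp add: image_mset_mset_set)
  then have 1: "image_mset card (mset_set ((`) \<delta> ` \<pi>)) = image_mset card (mset_set \<pi>)"
    by (simp add: image_mset.compositionality o_def cs)
  have R: "block_of \<pi> n \<in> \<pi>" "n \<in> block_of \<pi> n" using block_of[OF p] assms(3) by auto
  have "\<delta> n = n" using permutes_not_in[OF assms(1)] by simp
  then have "block_of ((`) \<delta> ` \<pi>) n = \<delta> ` block_of \<pi> n"
    using R by (intro block_of_eq[OF p']) (auto intro: image_eqI[of n \<delta> n])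
  then show ?thesis by (simp add: block_type_def 1 cs)
qed

lemma image_image_inv:
  assumes "\<delta> permutes S"
  shows "(`) (inv \<delta>) ` (`) \<delta> ` \<pi> = \<pi>" "(`) \<delta> ` (`) (inv \<delta>) ` \<pi> = \<pi>"
  by (simp_all add: image_image image_comp o_def permutes_inverses[OF assms])

text \<open>By independence, the averages of \<open>c\<close> over the orbits of the permutations fixing \<open>n\<close> vanish,
  and these orbits refine the classes of \<open>part_sim\<close>.\<close>

lemma class_sum_zero_of_symmetrized_zero:
  assumes n: "1 \<le> n"
    and zero: "\<And>\<kappa>. \<kappa> \<in> Pi\<^sub>E {1..n} (\<lambda>_. {1..n}) \<Longrightarrow>
      (\<Sum>\<delta> | \<delta> permutes {1..<n}. \<Sum>\<pi>\<in>set_partitions n. c \<pi> * e_basis \<pi> (\<kappa> \<circ> \<delta>)) = (0::real)"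
    and \<pi>: "\<pi> \<in> set_partitions n"
  shows "(\<Sum>\<sigma>\<in>{\<sigma>\<in>set_partitions n. part_sim n \<pi> \<sigma>}. c \<sigma>) = 0"
proof -
  let ?P = "set_partitions n" and ?S = "{\<delta>. \<delta> permutes {1..<n}}"
  let ?K = "{\<sigma>\<in>?P. part_sim n \<pi> \<sigma>}"
  have P: "?P = {\<pi>. partition_on {1..n} \<pi>}" by (simp add: set_partitions_def)
  define b where "b \<sigma> = (\<Sum>\<delta>\<in>?S. c ((`) (inv \<delta>) ` \<sigma>))" for \<sigma>
  have b0: "b \<tau> = 0" if "\<tau> \<in> ?P" for \<tau>
  proof (rule e_basis_independent[of "{1..n}" "min_colouring {1..n}"])
    fix \<sigma> assume \<sigma>: "partition_on {1..n} \<sigma>"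
    show "kernel_partition {1..n} (min_colouring {1..n} \<sigma>) = \<sigma>"
      by (rule kernel_min_colouring[OF _ \<sigma>]) simp
    let ?\<kappa> = "min_colouring {1..n} \<sigma>"
    have "0 = (\<Sum>\<delta>\<in>?S. \<Sum>\<pi>\<in>?P. c \<pi> * e_basis \<pi> (?\<kappa> \<circ> \<delta>))"
      using zero[OF min_colouring_PiE[OF _ \<sigma>]] by simp
    also have "\<dots> = (\<Sum>\<delta>\<in>?S. \<Sum>\<pi>\<in>?P. c ((`) (inv \<delta>) ` \<pi>) * e_basis \<pi> ?\<kappa>)"
    proof (rule sum.cong[OF refl])
      fix \<delta> assume "\<delta> \<in> ?S"
      then have d: "\<delta> permutes {1..<n}" by simp
      show "(\<Sum>\<pi>\<in>?P. c \<pi> * e_basis \<pi> (?\<kappa> \<circ> \<delta>)) = (\<Sum>\<pi>\<in>?P. c ((`) (inv \<delta>) ` \<pi>) * e_basis \<pi> ?\<kappa>)"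
        by (rule sum.reindex_bij_witness[of _ "(`) ((`) (inv \<delta>))" "(`) ((`) \<delta>)"])
           (simp_all add: image_image_inv[OF d] set_partitions_image_permutes[OF d]
             set_partitions_image_permutes[OF permutes_inv[OF d]] e_basis_compose[OF permutes_inj[OF d]])
    qed
    also have "\<dots> = (\<Sum>\<pi>\<in>?P. b \<pi> * e_basis \<pi> ?\<kappa>)"
      unfolding b_def sum_distrib_right by (rule sum.swap)
    finally show "(\<Sum>\<pi> | partition_on {1..n} \<pi>. b \<pi> * e_basis \<pi> ?\<kappa>) = 0"
      unfolding P by simp
  qed (use that in \<open>simp_all add: P\<close>)
  have "0 = (\<Sum>\<sigma>\<in>?K. b \<sigma>)"
    by (rule sum.neutral[symmetric]) (simp add: b0)
  also have "\<dots> = (\<Sum>\<delta>\<in>?S. \<Sum>\<sigma>\<in>?K. c ((`) (inv \<delta>) ` \<sigma>))"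
    unfolding b_def by (rule sum.swap)
  also have "\<dots> = (\<Sum>\<delta>\<in>?S. \<Sum>\<sigma>\<in>?K. c \<sigma>)"
  proof (rule sum.cong[OF refl])
    fix \<delta> assume "\<delta> \<in> ?S"
    then have d: "\<delta> permutes {1..<n}" by simp
    show "(\<Sum>\<sigma>\<in>?K. c ((`) (inv \<delta>) ` \<sigma>)) = (\<Sum>\<sigma>\<in>?K. c \<sigma>)"
      by (rule sum.reindex_bij_witness[of _ "(`) ((`) \<delta>)" "(`) ((`) (inv \<delta>))"])
         (simp_all add: image_image_inv[OF d] set_partitions_image_permutes[OF d]
           set_partitions_image_permutes[OF permutes_inv[OF d]] part_sim_iff
           block_type_image_permutes[OF d _ n] block_type_image_permutes[OF permutes_inv[OF d] _ n])
  qed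
  also have "\<dots> = of_nat (card ?S) * (\<Sum>\<sigma>\<in>?K. c \<sigma>)"
    by simp
  finally have "of_nat (card ?S) * (\<Sum>\<sigma>\<in>?K. c \<sigma>) = 0" by simp
  moreover have "card ?S \<noteq> 0"
    using card_permutations[OF refl, of "{1..<n}"] by simp
  ultimately show ?thesis by simp
qed

text \<open>A monomial is the multiset of its letters; multiplying monomials adds multisets, and
  \<open>0\<close> is the empty one.\<close>

type_synonym colour_poly = "nat multiset \<Rightarrow>\<^sub>0 real"

abbreviation letter :: "nat \<Rightarrow> colour_poly" where
  "letter i \<equiv> Poly_Mapping.single {#i#} 1"

abbreviation scalar :: "real \<Rightarrow> colour_poly" where
  "scalar c \<equiv> Poly_Mapping.single 0 c"

interpretation colours: colour_alphabet "{1..N}" letter scalar for N :: nat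
  by unfold_locales (auto simp: single_add mult_single)

lemma prod_letter: "finite A \<Longrightarrow> (\<Prod>i\<in>A. letter (\<kappa> i)) = Poly_Mapping.single (image_mset \<kappa> (mset_set A)) 1"
  by (induction A rule: finite_induct) (auto simp: mult_single)

lemma lookup_rooted_sum:
  "Poly_Mapping.lookup (colours.rooted_sum N n f a) M
    = (\<Sum>\<kappa>\<in>{\<kappa>\<in>Pi\<^sub>E {1..n} (\<lambda>_. {1..N}). \<kappa> n = a \<and> image_mset \<kappa> (mset_set {1..<n}) = M}. f \<kappa>)"
proof -
  have "Poly_Mapping.lookup (colours.rooted_sum N n f a) M
    = (\<Sum>\<kappa>\<in>Pi\<^sub>E {1..n} (\<lambda>_. {1..N}). if \<kappa> n = a \<and> image_mset \<kappa> (mset_set {1..<n}) = M then f \<kappa> else 0)"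
    unfolding colours.rooted_sum_def lookup_sum
    by (intro sum.cong refl) (auto simp: prod_letter mult_single lookup_single when_def)
  also have "\<dots> = (\<Sum>\<kappa>\<in>{\<kappa>\<in>Pi\<^sub>E {1..n} (\<lambda>_. {1..N}). \<kappa> n = a \<and> image_mset \<kappa> (mset_set {1..<n}) = M}. f \<kappa>)"
    by (rule sum.inter_filter[symmetric]) (intro finite_PiE, auto)
  finally show ?thesis .
qed

text \<open>One coefficient of the rooted sum collects \<open>h\<close> over \<open>?F\<close>, the
  rearrangements of \<open>\<kappa>0\<close> with fixed last colour. The symmetrization
  \<open>?H\<close> is constant on \<open>?F\<close> and sums to zero there, so it vanishes; summing
  over \<open>?F\<close> spares any count of stabilizers.\<close>

lemma symmetrized_zero_of_rooted_sum_zero: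
  assumes "\<And>a. a \<in> {1..N} \<Longrightarrow> colours.rooted_sum N n h a = 0"
    and \<kappa>0: "\<kappa>0 \<in> Pi\<^sub>E {1..n} (\<lambda>_. {1..N})" and n: "1 \<le> n"
  shows "(\<Sum>\<delta> | \<delta> permutes {1..<n}. h (\<kappa>0 \<circ> \<delta>)) = 0"
proof -
  let ?S = "{\<delta>. \<delta> permutes {1..<n}}"
  let ?M = "\<lambda>\<kappa>. image_mset \<kappa> (mset_set {1..<n})"
  let ?F = "{\<kappa>\<in>Pi\<^sub>E {1..n} (\<lambda>_. {1..N}). \<kappa> n = \<kappa>0 n \<and> ?M \<kappa> = ?M \<kappa>0}"
  let ?H = "\<lambda>\<kappa>. \<Sum>\<delta>\<in>?S. h (\<kappa> \<circ> \<delta>)"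
  have finF: "finite ?F" by (rule finite_subset[of _ "Pi\<^sub>E {1..n} (\<lambda>_. {1..N})"]) (auto intro: finite_PiE)
  have "\<kappa>0 n \<in> {1..N}" using PiE_mem[OF \<kappa>0, of n] n by simp
  then have sF: "(\<Sum>\<kappa>\<in>?F. h \<kappa>) = 0"
    using lookup_rooted_sum[of N n h "\<kappa>0 n" "?M \<kappa>0"] assms(1) by simp
  have comp: "\<kappa> \<circ> \<delta> \<in> ?F" if "\<kappa> \<in> ?F" and d: "\<delta> permutes {1..<n}" for \<kappa> \<delta>
  proof -
    have k: "\<kappa> \<in> Pi\<^sub>E {1..n} (\<lambda>_. {1..N})" "\<kappa> n = \<kappa>0 n" "?M \<kappa> = ?M \<kappa>0" using that by auto
    have d': "\<delta> permutes {1..n}" by (rule permutes_subset[OF d]) auto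
    have "\<kappa> \<circ> \<delta> \<in> Pi\<^sub>E {1..n} (\<lambda>_. {1..N})"
    proof (rule PiE_I)
      fix i assume "i \<in> {1..n}"
      then have "\<delta> i \<in> {1..n}" using permutes_in_image[OF d'] by simp
      then show "(\<kappa> \<circ> \<delta>) i \<in> {1..N}" using PiE_mem[OF k(1)] by simp
    next
      fix i assume "i \<notin> {1..n}"
      then show "(\<kappa> \<circ> \<delta>) i = undefined" using permutes_not_in[OF d'] PiE_arb[OF k(1)] by simp
    qed
    moreover have "(\<kappa> \<circ> \<delta>) n = \<kappa>0 n" using permutes_not_in[OF d, of n] k(2) by simp
    moreover have "?M (\<kappa> \<circ> \<delta>) = ?M \<kappa>0"
    proof -
      have "?M (\<kappa> \<circ> \<delta>) = image_mset \<kappa> (image_mset \<delta> (mset_set {1..<n}))"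
        by (simp add: image_mset.compositionality)
      also have "image_mset \<delta> (mset_set {1..<n}) = mset_set {1..<n}"
        by (rule permutes_image_mset[OF d])
      finally show ?thesis by (simp only: k(3))
    qed
    ultimately show ?thesis by simp
  qed
  have "(\<Sum>\<kappa>\<in>?F. h (\<kappa> \<circ> \<delta>)) = 0" if d: "\<delta> permutes {1..<n}" for \<delta>
  proof -
    have "(\<Sum>\<kappa>\<in>?F. h (\<kappa> \<circ> \<delta>)) = (\<Sum>\<kappa>\<in>?F. h \<kappa>)"
    proof (rule sum.reindex_bij_witness[of _ "\<lambda>\<kappa>. \<kappa> \<circ> inv \<delta>" "\<lambda>\<kappa>. \<kappa> \<circ> \<delta>"])
      fix \<kappa> assume k: "\<kappa> \<in> ?F"
      show "\<kappa> \<circ> \<delta> \<circ> inv \<delta> = \<kappa>" "\<kappa> \<circ> inv \<delta> \<circ> \<delta> = \<kappa>"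
        by (simp_all add: fun_eq_iff permutes_inverses[OF d])
      show "\<kappa> \<circ> \<delta> \<in> ?F" by (rule comp[OF k d])
      show "\<kappa> \<circ> inv \<delta> \<in> ?F" by (rule comp[OF k permutes_inv[OF d]])
    qed simp
    then show ?thesis using sF by simp
  qed
  then have "(\<Sum>\<delta>\<in>?S. \<Sum>\<kappa>\<in>?F. h (\<kappa> \<circ> \<delta>)) = 0"
    by (intro sum.neutral) auto
  then have "(\<Sum>\<kappa>\<in>?F. ?H \<kappa>) = 0"
    using sum.swap[of "\<lambda>\<delta> \<kappa>. h (\<kappa> \<circ> \<delta>)" ?F ?S] by simp
  moreover have "?H \<kappa> = ?H \<kappa>0" if "\<kappa> \<in> ?F" for \<kappa>
  proof -
    have k: "\<kappa> \<in> Pi\<^sub>E {1..n} (\<lambda>_. {1..N})" "\<kappa> n = \<kappa>0 n" "?M \<kappa> = ?M \<kappa>0" using that by auto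
    obtain p where p: "p permutes {1..<n}" "\<forall>i\<in>{1..<n}. \<kappa> i = \<kappa>0 (p i)"
      using image_mset_eq_implies_permutes[OF _ k(3)] by auto
    have "\<kappa> = \<kappa>0 \<circ> p"
    proof
      fix i
      consider "i \<in> {1..<n}" | "i = n" | "i \<notin> {1..n}" by force
      then show "\<kappa> i = (\<kappa>0 \<circ> p) i"
      proof cases
        case 1
        then show ?thesis using p(2) by simp
      next
        case 2
        then show ?thesis using k(2) permutes_not_in[OF p(1), of n] by simp
      next
        case 3
        then have "i \<notin> {1..<n}" by auto
        then show ?thesis
          using PiE_arb[OF k(1) 3] PiE_arb[OF \<kappa>0 3] permutes_not_in[OF p(1), of i] by simp
      qed
    qed
    then show ?thesis
      using setum_permutations_compose_left[OF p(1), of "\<lambda>\<delta>. h (\<kappa>0 \<circ> \<delta>)"] by (simp add: comp_assoc)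
  qed
  ultimately have "of_nat (card ?F) * ?H \<kappa>0 = 0"
    by simp
  moreover have "card ?F \<noteq> 0"
    using finF \<kappa>0 by auto
  ultimately show ?thesis by simp
qed

lemma YG_kernel_invariant:
  assumes "\<Union>G \<subseteq> A" "kernel_partition A \<kappa> = kernel_partition A \<kappa>'"
  shows "YG G \<kappa> = YG G \<kappa>'"
proof -
  have "\<kappa> i = \<kappa> j \<longleftrightarrow> \<kappa>' i = \<kappa>' j" if "{i, j} \<in> G" for i j
  proof -
    have "i \<in> A" "j \<in> A" using that assms(1) by auto
    then show ?thesis using assms(2) by (simp add: kernel_partition_eq_iff[of i A j])
  qed
  then have "proper_coloring G \<kappa> \<longleftrightarrow> proper_coloring G \<kappa>'"
    unfolding proper_coloring_def by blast
  then show ?thesis by (simp add: YG_def)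
qed

text \<open>The expansion c of \<open>YG G\<close> and the nonnegative d realizing its image have
  the same rooted sums. Over an alphabet with as many letters as vertices, equal rooted sums force
  equal class sums.\<close>

lemma semi_sym_e_positive_of_rooted_positive:
  assumes "1 \<le> p" "\<Union>G \<subseteq> {1..p}" "colours.rooted_positive p p (YG G)"
  shows "semi_sym_e_positive p G"
proof -
  let ?P = "set_partitions p"
  obtain F where F: "colours.pos1 p p F" "\<And>a. a \<in> {1..p} \<Longrightarrow> colours.rooted_sum p p (YG G) a = F (letter a)"
    using assms(3) unfolding colours.rooted_positive_def by blast
  obtain d where d: "\<forall>\<pi>\<in>?P. 0 \<le> d \<pi>"
    "\<forall>a\<in>{1..p}. F (letter a) = (\<Sum>\<pi>\<in>?P. scalar (d \<pi>) * colours.rooted_sum p p (e_basis \<pi>) a)"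
    using colours.realizable_pos1[OF F(1)] unfolding colours.realizable_def by blast
  have "espan {1..p} (YG G)"
    by (rule espan_of_kernel_invariant) (auto intro: YG_kernel_invariant[OF assms(2)])
  then obtain c where c: "\<And>\<kappa>. YG G \<kappa> = (\<Sum>\<pi>\<in>?P. c \<pi> * e_basis \<pi> \<kappa>)"
    unfolding espan_def set_partitions_def by blast
  have zero: "colours.rooted_sum p p (\<lambda>\<kappa>. \<Sum>\<pi>\<in>?P. (c \<pi> - d \<pi>) * e_basis \<pi> \<kappa>) a = 0" if "a \<in> {1..p}" for a
  proof -
    have "YG G = (\<lambda>\<kappa>. \<Sum>\<pi>\<in>?P. c \<pi> * e_basis \<pi> \<kappa>)" by (rule ext, rule c)
    then have "colours.rooted_sum p p (YG G) a = (\<Sum>\<pi>\<in>?P. scalar (c \<pi>) * colours.rooted_sum p p (e_basis \<pi>) a)"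
      by (simp only: colours.rooted_sum_sum)
    then have "(\<Sum>\<pi>\<in>?P. scalar (c \<pi>) * colours.rooted_sum p p (e_basis \<pi>) a)
      = (\<Sum>\<pi>\<in>?P. scalar (d \<pi>) * colours.rooted_sum p p (e_basis \<pi>) a)"
      using F(2) d(2) that by simp
    then show ?thesis
      unfolding colours.rooted_sum_sum single_diff by (simp add: left_diff_distrib sum_subtractf)
  qed
  have "(\<Sum>\<sigma>\<in>{\<sigma>\<in>?P. part_sim p \<pi> \<sigma>}. c \<sigma>) = (\<Sum>\<sigma>\<in>{\<sigma>\<in>?P. part_sim p \<pi> \<sigma>}. d \<sigma>)" if "\<pi> \<in> ?P" for \<pi>
  proof -
    have "(\<Sum>\<sigma>\<in>{\<sigma>\<in>?P. part_sim p \<pi> \<sigma>}. c \<sigma> - d \<sigma>) = 0"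
    proof (rule class_sum_zero_of_symmetrized_zero[OF assms(1) _ that])
      fix \<kappa> assume "\<kappa> \<in> Pi\<^sub>E {1..p} (\<lambda>_. {1..p})"
      from symmetrized_zero_of_rooted_sum_zero[OF zero this assms(1)]
      show "(\<Sum>\<delta> | \<delta> permutes {1..<p}. \<Sum>\<pi>\<in>?P. (c \<pi> - d \<pi>) * e_basis \<pi> (\<kappa> \<circ> \<delta>)) = 0" .
    qed
    then show ?thesis by (simp add: sum_subtractf)
  qed
  moreover have "e_expansion p (YG G) c" "e_expansion p (\<lambda>\<kappa>. \<Sum>\<pi>\<in>?P. d \<pi> * e_basis \<pi> \<kappa>) d"
    by (simp_all add: e_expansion_def c)
  ultimately show ?thesis
    unfolding semi_sym_e_positive_def sym_equiv_def using d(1) by blast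
qed

theorem mainTheorem13:
  fixes n m :: nat and E :: "nat set set"
  assumes "n \<ge> 1" and "m \<ge> 1"
    and "simple_graph n E"
    and "semi_sym_e_positive n E"
  shows "semi_sym_e_positive (n + m - 1) (graph_concat n E (TL m))"
proof (rule semi_sym_e_positive_of_rooted_positive)
  show "1 \<le> n + m - 1" using assms by simp
  show "\<Union>(graph_concat n E (TL m)) \<subseteq> {1..n + m - 1}"
    using assms by (intro vertices_graph_concat_TL)
  \<comment> \<open>The alphabet has one letter per vertex of the final graph. The smaller graph is
    treated over the same alphabet, its positivity being available for any number of
    letters.\<close>
  show "colours.rooted_positive (n + m - 1) (n + m - 1) (YG (graph_concat n E (TL m)))"
    using assms
    by (intro colours.rooted_positive_concat_TL colours.rooted_positive_of_semi_sym_e_positive)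
qed

end
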